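(* Let $p\ge1$, $n=2p$, let $Z$ be a rational anti-symmetric $n\times n$ matrix and let $\varTheta$ be an integer anti-symmetric $n\times n$ matrix such that $\varTheta-Z$ is invertible. Let $m$ be a positive integer with $mZ$ integral. Write $$mZ=R^{\intercal}\begin{pmatrix}0&\boldsymbol h&0\\ -\boldsymbol h&0&0\\ 0&0&0\end{pmatrix}R,\qquad m(\varTheta-Z)=Q^{\intercal}\begin{pmatrix}0&\boldsymbol t\\ -\boldsymbol t&0\end{pmatrix}Q,$$ with $R,Q\in\mathrm{GL}(n,\mathbb{Z})$, $\boldsymbol h=\mathrm{diag}(h_1,\dots,h_k)$, $\boldsymbol t=\mathrm{diag}(t_1,\dots,t_p)$, where the $h_j$ and $t_j$ are positive integers with $h_1\mid h_2\mid\cdots\mid h_k$ and $t_1\mid\cdots\mid t_p$ (alternating Smith normal forms; $2k$ is the rank of $Z$). Write $h_j/m=d_j/c_j$ with $\gcd(d_j,c_j)=1$, $c_j>0$, and set $\boldsymbol c=\mathrm{diag}(c_1,\dots,c_k)$, $\boldsymbol d=\mathrm{diag}(d_1,\dots,d_k)$. Let $T_1\in\mathrm{GL}(n,\mathbb{R})$ satisfy $T_1^{\intercal}J_1T_1=\varTheta-Z$, let $T_2=\begin{pmatrix}\boldsymbol d&0&0\\ 0&\boldsymbol 1_k&0\end{pmatrix}R$ (a $2k\times n$ matrix), and let $T=\begin{pmatrix} T_1 \\ T_2 \end{pmatrix}$. Let $\mathscr{D}$ be the image of $T(\mathbb{Z}^n)$ in $G=\mathbb{R}^{2p}\times\mathbb{Z}_{\boldsymbol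 c}\times\mathbb{Z}_{\boldsymbol c}$. Then the logical dimension $K$ of the associated code, i.e. the number $K\geq 0$ determined by $K^2=|\mathscr{D}^{\perp}/\mathscr{D}|$, is $$K=\bigl|\mathrm{Pf}(\varTheta-Z)\bigr|\,\det\boldsymbol c=\frac{\det\boldsymbol c\,\det\boldsymbol t}{m^{p}},$$ and $K$ is an integer.
   Context: $\mathbb{Z}_{\boldsymbol c}=\mathbb{Z}_{c_1}\times\cdots\times\mathbb{Z}_{c_k}$ with $\mathbb{Z}_c=\mathbb{Z}/c\mathbb{Z}$. $\boldsymbol 1_r$ is the $r\times r$ identity matrix. Put $$J_1=\begin{pmatrix}0&\boldsymbol 1_p\\ -\boldsymbol 1_p&0\end{pmatrix},\quad J_2=\begin{pmatrix}0&\boldsymbol c^{-1}\\ -\boldsymbol c^{-1}&0\end{pmatrix},\quad J=\begin{pmatrix}J_1&0\\ 0&J_2\end{pmatrix}.$$ The vectors of $T(\mathbb{Z}^n)$ lie in $\mathbb{R}^{2p}\times\mathbb{Z}^k\times\mathbb{Z}^k$, which maps onto $G$ by reducing the integer coordinates modulo the $c_j$. The bicharacter $\rho(x,y)=e^{2\pi i\langle x,Jy\rangle}$ on $G$ is computed on any lifts to $\mathbb{R}^{2p}\times\mathbb{Z}^k\times\mathbb{Z}^k$ and does not depend on them. For a lattice (discrete co-compact subgroup) $\mathscr{D}\subset G$, $\mathscr{D}^{\perp}=\{z\in G:\rho(z,y)=1\ \forall y\in\mathscr{D}\}$. Here $T^{\intercal}JT=\varTheta$ is an integer matrix, so $\mathscr{D}\subseteq\mathscr{D}^{\perp}$.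 $\mathscr{D}$ labels the commuting stabilizer displacements of the code, $\mathscr{D}^{\perp}$ labels the displacements commuting with all stabilizers, and $|\mathscr{D}^\perp/\mathscr{D}|$, the number of distinct logical operations, is the square of the logical dimension $K$. $\mathrm{Pf}$ denotes the Pfaffian of an anti-symmetric matrix. An empty determinant ($k=0$) equals $1$. *)

theory Defs
  imports
    "Jordan_Normal_Form.Determinant"
    "HOL-Algebra.Product_Groups"
    "HOL-Algebra.Elementary_Groups"
begin

definition antisym_mat :: "'a :: ab_group_add mat \<Rightarrow> bool" where
  "antisym_mat A \<longleftrightarrow> transpose_mat A = - A"

definition pfaffian :: "'a :: field_char_0 mat \<Rightarrow> 'a" where
  "pfaffian A = (let n = dim_row A; q = n div 2 in
     if odd n then 0
     else (\<Sum>\<sigma> | \<sigma> permutes {0..<n}.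
             of_int (sign \<sigma>) * (\<Prod>i<q. A $$ (\<sigma> (2 * i), \<sigma> (2 * i + 1))))
          / (2 ^ q * fact q))"

definition skew_block :: "nat \<Rightarrow> 'a :: ab_group_add mat \<Rightarrow> 'a mat" where
  "skew_block r B = four_block_mat (0\<^sub>m r r) B (- B) (0\<^sub>m r r)"

definition J1_mat :: "nat \<Rightarrow> real mat" where
  "J1_mat p = skew_block p (1\<^sub>m p)"

definition J2_mat :: "nat \<Rightarrow> (nat \<Rightarrow> nat) \<Rightarrow> real mat" where
  "J2_mat k c = skew_block k (mat_diag k (\<lambda>j. 1 / real (c j)))"

definition J_mat :: "nat \<Rightarrow> nat \<Rightarrow> (nat \<Rightarrow> nat) \<Rightarrow> real mat" where
  "J_mat p k c = four_block_mat (J1_mat p) (0\<^sub>m (2 * p) (2 * k)) (0\<^sub>m (2 * k) (2 * p)) (J2_mat k c)"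

definition T2_mat :: "nat \<Rightarrow> nat \<Rightarrow> (nat \<Rightarrow> int) \<Rightarrow> int mat \<Rightarrow> int mat" where
  "T2_mat n k d R =
     four_block_mat
       (four_block_mat (mat_diag k d) (0\<^sub>m k k) (0\<^sub>m k k) (1\<^sub>m k)) (0\<^sub>m (2 * k) (n - 2 * k))
       (0\<^sub>m 0 (2 * k)) (0\<^sub>m 0 (n - 2 * k)) * R"

text \<open>The real vectors that represent elements of \<open>\<real>\<^sup>2\<^sup>p \<times> \<int>\<^sup>k \<times> \<int>\<^sup>k\<close>.\<close>

definition lift_space :: "nat \<Rightarrow> nat \<Rightarrow> real vec set" where
  "lift_space p k = {v \<in> carrier_vec (2 * p + 2 * k). \<forall>j < 2 * k. v $ (2 * p + j) \<in> \<int>}"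

definition residue_prod :: "nat \<Rightarrow> (nat \<Rightarrow> nat) \<Rightarrow> (nat \<Rightarrow> int) monoid" where
  "residue_prod k c = product_group {..<k} (\<lambda>j. integer_mod_group (c j))"

type_synonym phase_point = "real vec \<times> (nat \<Rightarrow> int) \<times> (nat \<Rightarrow> int)"

definition phase_group :: "nat \<Rightarrow> nat \<Rightarrow> (nat \<Rightarrow> nat) \<Rightarrow> phase_point monoid" where
  "phase_group p k c = monoid_vec TYPE(real) (2 * p) \<times>\<times> (residue_prod k c \<times>\<times> residue_prod k c)"

text \<open>The surjection \<open>\<real>\<^sup>2\<^sup>p \<times> \<int>\<^sup>k \<times> \<int>\<^sup>k \<rightarrow> G\<close>.  The floor only converts the
  integer coordinates of a vector in \<^const>\<open>lift_space\<close> to type \<^typ>\<open>int\<close>.\<close>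

definition reduce_mod :: "nat \<Rightarrow> nat \<Rightarrow> (nat \<Rightarrow> nat) \<Rightarrow> real vec \<Rightarrow> phase_point" where
  "reduce_mod p k c v =
     (vec (2 * p) (\<lambda>i. v $ i),
      \<lambda>j\<in>{..<k}. \<lfloor>v $ (2 * p + j)\<rfloor> mod int (c j),
      \<lambda>j\<in>{..<k}. \<lfloor>v $ (2 * p + k + j)\<rfloor> mod int (c j))"

definition canonical_lift :: "nat \<Rightarrow> phase_point \<Rightarrow> real vec" where
  "canonical_lift k = (\<lambda>(x, u, v). x @\<^sub>v (vec k (\<lambda>j. of_int (u j)) @\<^sub>v vec k (\<lambda>j. of_int (v j))))"

definition rho_lift :: "nat \<Rightarrow> nat \<Rightarrow> (nat \<Rightarrow> nat) \<Rightarrow> real vec \<Rightarrow> real vec \<Rightarrow> complex" where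
  "rho_lift p k c x y = exp (2 * of_real pi * \<i> * of_real (x \<bullet> (J_mat p k c *\<^sub>v y)))"

definition rho :: "nat \<Rightarrow> nat \<Rightarrow> (nat \<Rightarrow> nat) \<Rightarrow> phase_point \<Rightarrow> phase_point \<Rightarrow> complex" where
  "rho p k c x y = rho_lift p k c (canonical_lift k x) (canonical_lift k y)"

definition lattice_image :: "nat \<Rightarrow> nat \<Rightarrow> (nat \<Rightarrow> nat) \<Rightarrow> nat \<Rightarrow> real mat \<Rightarrow> phase_point set" where
  "lattice_image p k c n T =
     reduce_mod p k c ` {T *\<^sub>v map_vec real_of_int z |z. z \<in> carrier_vec n}"

definition dual_lattice :: "nat \<Rightarrow> nat \<Rightarrow> (nat \<Rightarrow> nat) \<Rightarrow> phase_point set \<Rightarrow> phase_point set" where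
  "dual_lattice p k c D =
     {z \<in> carrier (phase_group p k c). \<forall>y\<in>D. rho p k c z y = 1}"

definition logical_quotient :: "nat \<Rightarrow> nat \<Rightarrow> (nat \<Rightarrow> nat) \<Rightarrow> phase_point set \<Rightarrow> phase_point set monoid" where
  "logical_quotient p k c D = phase_group p k c \<lparr>carrier := dual_lattice p k c D\<rparr> Mod D"

text \<open>The remaining lemmas show that \<^const>\<open>rho\<close> can be computed on arbitrary lifts.\<close>

lemma J_pairing:
  assumes x: "x \<in> carrier_vec (2 * p + 2 * k)" and y: "y \<in> carrier_vec (2 * p + 2 * k)"
  shows "x \<bullet> (J_mat p k c *\<^sub>v y) =
     vec (2 * p) (\<lambda>i. x $ i) \<bullet> (J1_mat p *\<^sub>v vec (2 * p) (\<lambda>i. y $ i)) +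
     (\<Sum>j<k. (x $ (2 * p + j) * y $ (2 * p + k + j) - x $ (2 * p + k + j) * y $ (2 * p + j)) / real (c j))"
proof -
  define first where "first v = vec (2 * p) (\<lambda>i. v $ i)" for v :: "real vec"
  define U where "U v = vec k (\<lambda>i. v $ (2 * p + i))" for v :: "real vec"
  define V where "V v = vec k (\<lambda>i. v $ (2 * p + k + i))" for v :: "real vec"
  let ?C = "mat_diag k (\<lambda>j. 1 / real (c j)) :: real mat"
  have split: "v = first v @\<^sub>v (U v @\<^sub>v V v)" if "v \<in> carrier_vec (2 * p + 2 * k)" for v
    using that by (intro eq_vecI) (auto simp: first_def U_def V_def algebra_simps)
  have c1: "first v \<in> carrier_vec (2 * p)" "U v \<in> carrier_vec k" "V v \<in> carrier_vec k"
    "U v @\<^sub>v V v \<in> carrier_vec (2 * k)" for v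
    by (auto simp: first_def U_def V_def intro!: carrier_vecI)
  have CC: "?C \<in> carrier_mat k k" "- ?C \<in> carrier_mat k k" by auto
  have Cdim: "dim_row ?C = k" "dim_col ?C = k" by (auto simp: mat_diag_def)
  have J1: "J1_mat p \<in> carrier_mat (2 * p) (2 * p)"
    unfolding J1_mat_def skew_block_def by (auto intro!: carrier_matI)
  have J2: "J2_mat k c \<in> carrier_mat (2 * k) (2 * k)"
    unfolding J2_mat_def skew_block_def by (auto simp: mat_diag_def intro!: carrier_matI)
  have zero: "0\<^sub>m r s *\<^sub>v w = 0\<^sub>v r" if "w \<in> carrier_vec s" for w :: "real vec" and r s
    using that by (intro eq_vecI) auto
  have J2v: "J2_mat k c *\<^sub>v (U y @\<^sub>v V y) = (?C *\<^sub>v V y) @\<^sub>v ((- ?C) *\<^sub>v U y)"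
    unfolding J2_mat_def skew_block_def
    by (subst four_block_mat_mult_vec[OF _ CC(1) CC(2)])
       (use c1 CC in \<open>auto simp: zero intro!: arg_cong2[of _ _ _ _ append_vec] left_zero_vec[of _ k] right_zero_vec[of _ k] mult_mat_vec_carrier[of _ k k]\<close>)
  have J2v_carrier: "(?C *\<^sub>v V y) @\<^sub>v ((- ?C) *\<^sub>v U y) \<in> carrier_vec (2 * k)"
    unfolding J2v[symmetric] using J2 c1(4) by (rule mult_mat_vec_carrier)
  have Jv: "J_mat p k c *\<^sub>v y = (J1_mat p *\<^sub>v first y) @\<^sub>v ((?C *\<^sub>v V y) @\<^sub>v ((- ?C) *\<^sub>v U y))"
    unfolding J_mat_def
    by (subst split[OF y], subst four_block_mat_mult_vec[OF J1 _ _ J2 c1(1) c1(4)])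
       (use J1 J2 c1 J2v J2v_carrier in \<open>auto simp: zero[OF c1(1)] zero[OF c1(4)]
          intro!: arg_cong2[of _ _ _ _ append_vec] left_zero_vec[of _ "2 * k"] right_zero_vec[of _ "2 * p"]
            mult_mat_vec_carrier[of _ "2 * p" "2 * p"]\<close>)
  have diag: "(?C *\<^sub>v w) $ j = w $ j / real (c j)" if "j < k" "w \<in> carrier_vec k" for w j
  proof -
    have "(?C *\<^sub>v w) $ j = (\<Sum>i = 0..<k. (if j = i then 1 / real (c i) else 0) * w $ i)"
      using that by (auto simp: mat_diag_def scalar_prod_def intro!: sum.cong)
    also have "\<dots> = (\<Sum>i = 0..<k. if j = i then w $ i / real (c i) else 0)"
      by (rule sum.cong) auto
    finally show ?thesis using that by simp
  qed
  have neg: "(- ?C) *\<^sub>v w = - (?C *\<^sub>v w)" if "w \<in> carrier_vec k" for w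
    using that CC by (intro eq_vecI) (auto simp: scalar_prod_def sum_negf mat_diag_def)
  have c2: "J1_mat p *\<^sub>v first y \<in> carrier_vec (2 * p)"
    "?C *\<^sub>v V y \<in> carrier_vec k" "(- ?C) *\<^sub>v U y \<in> carrier_vec k"
    by (rule mult_mat_vec_carrier[OF J1 c1(1)] mult_mat_vec_carrier[OF CC(1) c1(3)]
          mult_mat_vec_carrier[OF CC(2) c1(2)])+
  have "x \<bullet> (J_mat p k c *\<^sub>v y) =
      (first x @\<^sub>v (U x @\<^sub>v V x)) \<bullet> ((J1_mat p *\<^sub>v first y) @\<^sub>v ((?C *\<^sub>v V y) @\<^sub>v ((- ?C) *\<^sub>v U y)))"
    using split[OF x] Jv by simp
  also have "\<dots> = first x \<bullet> (J1_mat p *\<^sub>v first y) + (U x \<bullet> (?C *\<^sub>v V y) + V x \<bullet> ((- ?C) *\<^sub>v U y))"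
    by (simp only: scalar_prod_append[OF c1(1) c1(4) c2(1) J2v_carrier]
          scalar_prod_append[OF c1(2) c1(3) c2(2) c2(3)])
  also have "U x \<bullet> (?C *\<^sub>v V y) = (\<Sum>j<k. x $ (2 * p + j) * y $ (2 * p + k + j) / real (c j))"
    using c1 CC unfolding scalar_prod_def
    by (auto simp: Cdim diag simp del: index_mult_mat_vec simp: U_def V_def lessThan_atLeast0 intro!: sum.cong)
  also have "V x \<bullet> ((- ?C) *\<^sub>v U y) = - (\<Sum>j<k. x $ (2 * p + k + j) * y $ (2 * p + j) / real (c j))"
    using c1 CC unfolding scalar_prod_def neg[OF c1(2)] sum_negf[symmetric]
    by (auto simp: Cdim diag simp del: index_mult_mat_vec simp: U_def V_def lessThan_atLeast0 intro!: sum.cong)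
  finally show ?thesis
    by (simp add: first_def diff_divide_distrib sum_subtractf)
qed

lemma canonical_lift_reduce_mod:
  "canonical_lift k (reduce_mod p k c x) \<in> carrier_vec (2 * p + 2 * k)"
  "i < 2 * p \<Longrightarrow> canonical_lift k (reduce_mod p k c x) $ i = x $ i"
  "j < k \<Longrightarrow> canonical_lift k (reduce_mod p k c x) $ (2 * p + j) = of_int (\<lfloor>x $ (2 * p + j)\<rfloor> mod int (c j))"
  "j < k \<Longrightarrow> canonical_lift k (reduce_mod p k c x) $ (2 * p + k + j) = of_int (\<lfloor>x $ (2 * p + k + j)\<rfloor> mod int (c j))"
  by (auto simp: canonical_lift_def reduce_mod_def intro!: carrier_vecI)

lemma mod_pairing_diff_Ints:
  fixes a b a' b' :: int and c :: nat
  assumes "c > 0"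
  shows "(of_int a * of_int b' - of_int b * of_int a') / real c
       - (of_int (a mod int c) * of_int (b' mod int c) - of_int (b mod int c) * of_int (a' mod int c)) / real c \<in> \<int>"
proof -
  have "int c dvd (a * b' - b * a') - ((a mod int c) * (b' mod int c) - (b mod int c) * (a' mod int c))"
    unfolding mod_eq_dvd_iff[symmetric] by (rule mod_diff_cong) (simp_all add: mod_mult_eq)
  then obtain q where q: "(a * b' - b * a') - ((a mod int c) * (b' mod int c) - (b mod int c) * (a' mod int c)) = int c * q"
    by (elim dvdE)
  have "(of_int a * of_int b' - of_int b * of_int a') / real c
       - (of_int (a mod int c) * of_int (b' mod int c) - of_int (b mod int c) * of_int (a' mod int c)) / real c
       = real_of_int ((a * b' - b * a') - ((a mod int c) * (b' mod int c) - (b mod int c) * (a' mod int c))) / real c"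
    by (simp add: diff_divide_distrib)
  also have "\<dots> = real_of_int q" unfolding q using assms by simp
  finally show ?thesis by simp
qed

lemma rho_reduce_mod:
  assumes c: "\<forall>j<k. c j > 0" and x: "x \<in> lift_space p k" and y: "y \<in> lift_space p k"
  shows "rho p k c (reduce_mod p k c x) (reduce_mod p k c y) = rho_lift p k c x y"
proof -
  let ?x = "canonical_lift k (reduce_mod p k c x)" and ?y = "canonical_lift k (reduce_mod p k c y)"
  have carr: "x \<in> carrier_vec (2 * p + 2 * k)" "y \<in> carrier_vec (2 * p + 2 * k)"
    using x y by (auto simp: lift_space_def)
  have fl: "v $ (2 * p + j) = of_int \<lfloor>v $ (2 * p + j)\<rfloor>"
    "v $ (2 * p + k + j) = of_int \<lfloor>v $ (2 * p + k + j)\<rfloor>" if "v \<in> lift_space p k" "j < k" for v j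
  proof -
    have I: "v $ (2 * p + i) \<in> \<int>" if "i < 2 * k" for i
      using that \<open>v \<in> lift_space p k\<close> by (auto simp: lift_space_def)
    show "v $ (2 * p + j) = of_int \<lfloor>v $ (2 * p + j)\<rfloor>"
      "v $ (2 * p + k + j) = of_int \<lfloor>v $ (2 * p + k + j)\<rfloor>"
      using I[of j] I[of "k + j"] \<open>j < k\<close> by (auto simp: add.assoc elim!: Ints_cases)
  qed
  have first: "vec (2 * p) (\<lambda>i. ?x $ i) = vec (2 * p) (\<lambda>i. x $ i)"
    "vec (2 * p) (\<lambda>i. ?y $ i) = vec (2 * p) (\<lambda>i. y $ i)"
    by (auto simp: canonical_lift_reduce_mod)
  have "x \<bullet> (J_mat p k c *\<^sub>v y) - ?x \<bullet> (J_mat p k c *\<^sub>v ?y) =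
     (\<Sum>j<k. (x $ (2 * p + j) * y $ (2 * p + k + j) - x $ (2 * p + k + j) * y $ (2 * p + j)) / real (c j)
        - (?x $ (2 * p + j) * ?y $ (2 * p + k + j) - ?x $ (2 * p + k + j) * ?y $ (2 * p + j)) / real (c j))"
    unfolding J_pairing[OF carr] J_pairing[OF canonical_lift_reduce_mod(1) canonical_lift_reduce_mod(1)] first
    by (simp add: sum_subtractf)
  also have "\<dots> \<in> \<int>"
  proof (rule Ints_sum)
    fix j assume "j \<in> {..<k}"
    then have j: "j < k" by simp
    show "(x $ (2 * p + j) * y $ (2 * p + k + j) - x $ (2 * p + k + j) * y $ (2 * p + j)) / real (c j)
        - (?x $ (2 * p + j) * ?y $ (2 * p + k + j) - ?x $ (2 * p + k + j) * ?y $ (2 * p + j)) / real (c j) \<in> \<int>"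
      unfolding canonical_lift_reduce_mod(3,4)[OF j]
      by (subst fl(1)[OF x j], subst fl(2)[OF x j], subst fl(1)[OF y j], subst fl(2)[OF y j],
          rule mod_pairing_diff_Ints) (use c j in auto)
  qed
  finally obtain q where q: "x \<bullet> (J_mat p k c *\<^sub>v y) - ?x \<bullet> (J_mat p k c *\<^sub>v ?y) = of_int q"
    by (elim Ints_cases)
  then have "x \<bullet> (J_mat p k c *\<^sub>v y) = ?x \<bullet> (J_mat p k c *\<^sub>v ?y) + of_int q" by simp
  then have "rho_lift p k c x y = rho_lift p k c ?x ?y * exp (2 * of_real pi * \<i> * of_int q)"
    by (simp add: rho_lift_def exp_add[symmetric] algebra_simps)
  also have "exp (2 * of_real pi * \<i> * of_int q) = (1 :: complex)"
    using cis_multiple_2pi[of "of_int q"] by (simp add: cis_conv_exp mult_ac)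
  finally show ?thesis by (simp add: rho_def)
qed

end

theory Submission
  imports Defs
begin

text \<open>
  Let \<open>A = \<Theta> - Z = T\<^sub>1\<^sup>T J\<^sub>1 T\<^sub>1\<close> and write a lift of a point of \<open>G\<close> as \<open>(x, w)\<close>.  Since \<open>J\<^sub>1 T\<^sub>1\<close> is invertible, \<open>x\<close> is
  determined by \<open>w\<close> and \<open>g = T\<^sup>T J (x, w)\<close>, and the point lies in the dual lattice iff \<open>g\<close> is integral.
  In the coordinates \<open>(g, w)\<close> the dual lattice becomes \<open>\<int>\<^sup>n \<times> \<int>\<^sup>2\<^sup>k\<close>, while the preimage of \<open>\<D>\<close> is spanned
  by the columns of an integer matrix which factors as
  \<open>(T\<^sub>1\<^sup>T J\<^sub>1, T\<^sub>2\<^sup>T J\<^sub>2; 0, 1) (T\<^sub>1, 0; T\<^sub>2, C)\<close>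
  with \<open>C = diag(c, c)\<close>.  Its determinant is \<open>(det T\<^sub>1 det c)\<^sup>2\<close>, which is therefore \<open>K\<^sup>2\<close>; and
  \<open>Pf A = \<plusminus> det T\<^sub>1\<close>.  Integrality holds because \<open>K\<close> is rational with integral square.
\<close>

section \<open>Index of an integral lattice\<close>

text \<open>The obstacle is that \<open>G\<close> mixes a continuous part with torsion, so the
  quotient is not visibly a quotient of two full-rank lattices. Lifting repairs this: the kernel of
  the reduction is added to \<open>D\<close> as \<open>2 k\<close> further generators, and both
  groups turn into lattices of rank \<open>n + 2 k\<close>. The generator matrix is integral for two
  separate reasons. The form pulled back along \<open>T1\<close> is only the rational matrix
  \<open>\<Theta> - Z\<close>, but the form pulled back along \<open>T2\<close> is \<open>Z\<close>,
  because \<open>d / c = h / m\<close>; the sum is \<open>\<Theta>\<close>. In the torsion columns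
  the moduli cancel the denominators of \<open>J2_mat\<close>. Since \<open>K\<close> is wanted and
  not only its square, the first formula needs the Pfaffian up to sign; as it is defined by a sum
  over permutations, it is evaluated by expanding that sum. The formula with \<open>t\<close> comes
  from comparing two values of \<open>det (\<Theta> - Z)\<close>.\<close>

definition row_lattice :: "int mat \<Rightarrow> int vec set" where
  "row_lattice A = {transpose_mat A *\<^sub>v z | z. z \<in> carrier_vec (dim_row A)}"

text \<open>A transversal of the integer vectors modulo \<open>L\<close>. Counting representatives
  instead of working in a quotient group allows an explicit construction by induction on the
  dimension.\<close>

definition coset_reps :: "nat \<Rightarrow> int vec set \<Rightarrow> int vec set \<Rightarrow> bool" where
  "coset_reps n L S \<longleftrightarrow> S \<subseteq> carrier_vec n \<and> (\<forall>v \<in> carrier_vec n. \<exists>!s. s \<in> S \<and> v - s \<in> L)"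

text \<open>The adjugate formula needs no division here: a determinant of absolute value 1 is its
  own reciprocal.\<close>

lemma int_mat_unimodular_inverse:
  fixes U :: "int mat"
  assumes U: "U \<in> carrier_mat n n" and det: "\<bar>det U\<bar> = 1"
  obtains V where "V \<in> carrier_mat n n" "V * U = 1\<^sub>m n"
proof
  show "det U \<cdot>\<^sub>m adj_mat U \<in> carrier_mat n n" using adj_mat(1)[OF U] by simp
  have "det U * det U = 1" using det by (auto simp: abs_if split: if_splits)
  then show "(det U \<cdot>\<^sub>m adj_mat U) * U = 1\<^sub>m n"
    using adj_mat[OF U] U by (subst mult_smult_assoc_mat[of _ n n _ n]) (auto intro!: eq_matI simp: mult.assoc[symmetric])
qed

lemma row_lattice_mult_subset:
  assumes A: "A \<in> carrier_mat n m" and U: "U \<in> carrier_mat n n"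
  shows "row_lattice (U * A) \<subseteq> row_lattice A"
proof
  fix x assume "x \<in> row_lattice (U * A)"
  then obtain z where z: "z \<in> carrier_vec n" and x: "x = transpose_mat (U * A) *\<^sub>v z"
    using U by (auto simp: row_lattice_def)
  have "x = transpose_mat A *\<^sub>v (transpose_mat U *\<^sub>v z)"
    unfolding x using A U z by (subst transpose_mult[OF U A]) (auto intro!: assoc_mult_mat_vec)
  then show "x \<in> row_lattice A"
    using A U z by (auto simp: row_lattice_def intro!: exI[of _ "transpose_mat U *\<^sub>v z"])
qed

lemma row_lattice_unimodular:
  assumes A: "A \<in> carrier_mat n m" and U: "U \<in> carrier_mat n n" "\<bar>det U\<bar> = 1"
  shows "row_lattice (U * A) = row_lattice A"
proof
  obtain V where V: "V \<in> carrier_mat n n" "V * U = 1\<^sub>m n"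
    by (rule int_mat_unimodular_inverse[OF U])
  have "A = V * (U * A)"
    using A U V by (subst assoc_mult_mat[symmetric, of _ n n _ n _ m]) auto
  then show "row_lattice A \<subseteq> row_lattice (U * A)"
    using row_lattice_mult_subset[of "U * A" n m V] A U V by auto
qed (rule row_lattice_mult_subset[OF A U(1)])

lemma transpose_mult_vCons:
  fixes A :: "int mat"
  assumes A: "A \<in> carrier_mat (Suc n) (Suc n)" and z: "z \<in> carrier_vec n"
    and col: "\<forall>i<n. A $$ (Suc i, 0) = 0"
  shows "transpose_mat A *\<^sub>v vCons a z =
     vCons (a * A $$ (0, 0)) (vec n (\<lambda>j. a * A $$ (0, Suc j))
       + transpose_mat (mat n n (\<lambda>(i, j). A $$ (Suc i, Suc j))) *\<^sub>v z)"
proof (rule eq_vecI)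
  fix j assume "j < dim_vec (vCons (a * A $$ (0, 0)) (vec n (\<lambda>j. a * A $$ (0, Suc j))
       + transpose_mat (mat n n (\<lambda>(i, j). A $$ (Suc i, Suc j))) *\<^sub>v z))"
  then show "(transpose_mat A *\<^sub>v vCons a z) $ j = vCons (a * A $$ (0, 0)) (vec n (\<lambda>j. a * A $$ (0, Suc j))
       + transpose_mat (mat n n (\<lambda>(i, j). A $$ (Suc i, Suc j))) *\<^sub>v z) $ j"
    using A z col
    by (cases j) (auto simp: scalar_prod_def sum.atLeast0_lessThan_Suc_shift simp del: sum.op_ivl_Suc)
qed (use A z in auto)

text \<open>Only the first row reaches the first coordinate, so that coordinate fixes the
  coefficient \<open>a\<close>. The rest of the vector has to lie in the lattice of the minor once
  \<open>a\<close> times the first row is removed.\<close>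

lemma row_lattice_first_column:
  assumes A: "A \<in> carrier_mat (Suc n) (Suc n)" and col: "\<forall>i<n. A $$ (Suc i, 0) = 0"
    and w: "w \<in> carrier_vec n"
  shows "vCons b w \<in> row_lattice A \<longleftrightarrow>
    (\<exists>a. b = a * A $$ (0, 0) \<and>
      w - vec n (\<lambda>j. a * A $$ (0, Suc j)) \<in> row_lattice (mat n n (\<lambda>(i, j). A $$ (Suc i, Suc j))))"
    (is "_ \<longleftrightarrow> ?R")
proof
  let ?A = "mat n n (\<lambda>(i, j). A $$ (Suc i, Suc j))"
  assume "vCons b w \<in> row_lattice A"
  then obtain z0 where z0: "z0 \<in> carrier_vec (Suc n)" "vCons b w = transpose_mat A *\<^sub>v z0"
    using A by (auto simp: row_lattice_def)
  obtain a z where az: "z0 = vCons a z" "z \<in> carrier_vec n"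
    using z0(1) by (cases z0) auto
  from z0 az have "b = a * A $$ (0, 0)" "w = vec n (\<lambda>j. a * A $$ (0, Suc j)) + transpose_mat ?A *\<^sub>v z"
    by (auto simp: transpose_mult_vCons[OF A _ col])
  moreover from this(2) have "w - vec n (\<lambda>j. a * A $$ (0, Suc j)) = transpose_mat ?A *\<^sub>v z"
    using az by (auto intro!: eq_vecI)
  ultimately show ?R
    using az by (auto simp: row_lattice_def)
next
  let ?A = "mat n n (\<lambda>(i, j). A $$ (Suc i, Suc j))"
  assume ?R
  then obtain a z where *: "b = a * A $$ (0, 0)" "z \<in> carrier_vec n"
    "w - vec n (\<lambda>j. a * A $$ (0, Suc j)) = transpose_mat ?A *\<^sub>v z"
    by (auto simp: row_lattice_def)
  have "w = vec n (\<lambda>j. a * A $$ (0, Suc j)) + (w - vec n (\<lambda>j. a * A $$ (0, Suc j)))"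
    using w by (auto intro!: eq_vecI)
  then have "vCons b w = transpose_mat A *\<^sub>v vCons a z"
    using * w by (simp add: transpose_mult_vCons[OF A _ col])
  then show "vCons b w \<in> row_lattice A"
    using * A by (auto simp: row_lattice_def intro!: exI[of _ "vCons a z"])
qed

lemma det_first_column:
  assumes A: "A \<in> carrier_mat (Suc n) (Suc n)" and col: "\<forall>i<n. A $$ (Suc i, 0) = 0"
  shows "det A = A $$ (0, 0) * det (mat n n (\<lambda>(i, j). A $$ (Suc i, Suc j)))"
proof -
  have "A = four_block_mat (mat 1 1 (\<lambda>_. A $$ (0, 0))) (mat 1 n (\<lambda>(i, j). A $$ (0, Suc j)))
      (0\<^sub>m n 1) (mat n n (\<lambda>(i, j). A $$ (Suc i, Suc j)))"
    using A col by (intro eq_matI) (auto simp: less_Suc_eq_0_disj)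
  then have "det A = det (mat 1 1 (\<lambda>_. A $$ (0, 0))) * det (mat n n (\<lambda>(i, j). A $$ (Suc i, Suc j)))"
    using det_four_block_mat_lower_left_zero_col[of "mat 1 1 (\<lambda>_. A $$ (0, 0))" "mat 1 n (\<lambda>(i, j). A $$ (0, Suc j))" n
        "0\<^sub>m n 1" "mat n n (\<lambda>(i, j). A $$ (Suc i, Suc j))"] by simp
  then show ?thesis by (simp add: det_single)
qed

text \<open>Division with remainder in the first coordinate: the remainder is kept, the quotient
  shifts the tail along the first row, and the shifted tail is reduced by the representatives of the
  minor.\<close>

lemma coset_reps_first_column:
  assumes A: "A \<in> carrier_mat (Suc n) (Suc n)" and col: "\<forall>i<n. A $$ (Suc i, 0) = 0"
    and nz: "A $$ (0, 0) \<noteq> 0"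
    and S: "coset_reps n (row_lattice (mat n n (\<lambda>(i, j). A $$ (Suc i, Suc j)))) S"
  shows "coset_reps (Suc n) (row_lattice A)
    ((\<lambda>(b, s). vCons b s) ` ({0..<\<bar>A $$ (0, 0)\<bar>} \<times> S))"
  unfolding coset_reps_def
proof (intro conjI ballI)
  let ?L = "row_lattice (mat n n (\<lambda>(i, j). A $$ (Suc i, Suc j)))"
  define g where "g = A $$ (0, 0)"
  define r where "r a = vec n (\<lambda>j. a * A $$ (0, Suc j))" for a
  have r: "r a \<in> carrier_vec n" for a by (simp add: r_def)
  have Sc: "S \<subseteq> carrier_vec n" and Su: "\<And>v. v \<in> carrier_vec n \<Longrightarrow> \<exists>!s. s \<in> S \<and> v - s \<in> ?L"
    using S by (auto simp: coset_reps_def)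
  show "(\<lambda>(b, s). vCons b s) ` ({0..<\<bar>A $$ (0, 0)\<bar>} \<times> S) \<subseteq> carrier_vec (Suc n)"
    using Sc by auto
  fix v0 :: "int vec" assume "v0 \<in> carrier_vec (Suc n)"
  then obtain x v where v0: "v0 = vCons x v" and v: "v \<in> carrier_vec n" by (cases v0) auto
  have diff: "vCons x v - vCons b s = vCons (x - b) (v - s)" if "s \<in> carrier_vec n" for b s
    using v that by (intro eq_vecI) (auto simp: less_Suc_eq_0_disj)
  have mem: "v0 - vCons b s \<in> row_lattice A \<longleftrightarrow> (\<exists>a. x - b = a * g \<and> (v - r a) - s \<in> ?L)"
    if "s \<in> S" for b s
  proof -
    have s: "s \<in> carrier_vec n" using that Sc by auto
    have "v - s - r a = v - r a - s" for a using v s r[of a] by (intro eq_vecI) auto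
    then show ?thesis
      using v s unfolding v0 diff[OF s] g_def
      by (subst row_lattice_first_column[OF A col]) (auto simp: r_def)
  qed
  define b0 where "b0 = x mod \<bar>g\<bar>"
  define a0 where "a0 = (x - b0) div g"
  have "\<bar>g\<bar> dvd x - b0" unfolding b0_def by (rule dvd_minus_mod)
  then have a0: "x - b0 = a0 * g" by (simp add: a0_def)
  have b0: "0 \<le> b0" "b0 < \<bar>g\<bar>" using nz by (auto simp: b0_def g_def)
  have uniq: "b = b0 \<and> a = a0" if "0 \<le> b" "b < \<bar>g\<bar>" "x - b = a * g" for a b
  proof -
    have "b mod \<bar>g\<bar> = x mod \<bar>g\<bar>"
    proof -
      have "b - x = - a * g" using that(3) by simp
      then have "g dvd b - x" by simp
      then show ?thesis by (simp add: mod_eq_dvd_iff)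
    qed
    then have "b = b0" using that by (simp add: b0_def)
    then show ?thesis using that(3) a0 nz by (auto simp: g_def)
  qed
  \<comment> \<open>The representative of the tail depends on the first coordinate through the
    quotient \<open>a0\<close>.\<close>
  obtain s0 where s0: "s0 \<in> S" "(v - r a0) - s0 \<in> ?L"
    and s0u: "\<And>s. s \<in> S \<Longrightarrow> (v - r a0) - s \<in> ?L \<Longrightarrow> s = s0"
    using Su[OF minus_carrier_vec[OF v r], of a0] by blast
  show "\<exists>!s. s \<in> (\<lambda>(b, s). vCons b s) ` ({0..<\<bar>A $$ (0, 0)\<bar>} \<times> S) \<and> v0 - s \<in> row_lattice A"
  proof (rule ex1I[of _ "vCons b0 s0"])
    show "vCons b0 s0 \<in> (\<lambda>(b, s). vCons b s) ` ({0..<\<bar>A $$ (0, 0)\<bar>} \<times> S) \<and> v0 - vCons b0 s0 \<in> row_lattice A"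
      using b0 s0 a0 mem[OF s0(1)] by (auto simp: g_def)
  next
    fix y assume y: "y \<in> (\<lambda>(b, s). vCons b s) ` ({0..<\<bar>A $$ (0, 0)\<bar>} \<times> S) \<and> v0 - y \<in> row_lattice A"
    then obtain b s where bs: "y = vCons b s" "0 \<le> b" "b < \<bar>g\<bar>" "s \<in> S" by (auto simp: g_def)
    then obtain a where "x - b = a * g" "(v - r a) - s \<in> ?L" using y mem by auto
    then show "y = vCons b0 s0" using uniq bs s0u by auto
  qed
qed

text \<open>Row operations change neither the lattice nor the absolute value of the determinant, so
  the first column may be cleared by Euclid's algorithm before passing to the minor.\<close>

lemma ex_coset_reps:
  assumes "A \<in> carrier_mat n n" "det A \<noteq> 0"
  shows "\<exists>S. coset_reps n (row_lattice A) S \<and> finite S \<and> card S = nat \<bar>det A\<bar>"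
  using assms
proof (induction n arbitrary: A)
  case 0
  have "coset_reps 0 (row_lattice A) {0\<^sub>v 0}"
    using 0 by (auto simp: coset_reps_def row_lattice_def intro!: exI[of _ "0\<^sub>v 0"])
  then show ?case using 0 by (intro exI[of _ "{0\<^sub>v 0}"]) auto
next
  case (Suc n)
  \<comment> \<open>Once the column is clear, the determinant is the corner entry times that of the
    minor, and the induction on the dimension applies.\<close>
  have cleared: "\<exists>S. coset_reps (Suc n) (row_lattice A) S \<and> finite S \<and> card S = nat \<bar>det A\<bar>"
    if A: "A \<in> carrier_mat (Suc n) (Suc n)" "det A \<noteq> 0" and col: "\<forall>i<n. A $$ (Suc i, 0) = 0" for A
  proof -
    let ?A = "mat n n (\<lambda>(i, j). A $$ (Suc i, Suc j))"
    note det = det_first_column[OF A(1) col]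
    obtain S where S: "coset_reps n (row_lattice ?A) S" "finite S" "card S = nat \<bar>det ?A\<bar>"
      using Suc.IH[of ?A] A(2) det by auto
    let ?S = "(\<lambda>(b, s). vCons b s) ` ({0..<\<bar>A $$ (0, 0)\<bar>} \<times> S)"
    have "inj_on (\<lambda>(b, s). vCons b s) ({0..<\<bar>A $$ (0, 0)\<bar>} \<times> S)" by (auto simp: inj_on_def)
    then have "card ?S = nat \<bar>A $$ (0, 0)\<bar> * nat \<bar>det ?A\<bar>"
      by (simp add: card_image card_cartesian_product S)
    also have "\<dots> = nat \<bar>det A\<bar>" by (simp add: det abs_mult nat_mult_distrib)
    finally have card: "card ?S = nat \<bar>det A\<bar>" .
    have "A $$ (0, 0) \<noteq> 0" using A(2) det by auto
    from coset_reps_first_column[OF A(1) col this S(1)] show ?thesis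
      using card S(2) by (intro exI[of _ ?S] conjI) simp_all
  qed
  \<comment> \<open>The inner induction runs Euclid's algorithm; its measure is the sum of the
    absolute values in the first column.\<close>
  show ?case using Suc.prems
  proof (induction "\<Sum>i<Suc n. nat \<bar>A $$ (i, 0)\<bar>" arbitrary: A rule: less_induct)
    case less
    note A = less.prems(1)
    consider (pair) i j where "i < Suc n" "j < Suc n" "i \<noteq> j" "A $$ (i, 0) \<noteq> 0" "A $$ (j, 0) \<noteq> 0"
        "\<bar>A $$ (i, 0)\<bar> \<le> \<bar>A $$ (j, 0)\<bar>"
      | (single) k where "\<forall>i<Suc n. i \<noteq> k \<longrightarrow> A $$ (i, 0) = 0" "k < Suc n"
    proof (cases "\<exists>k<Suc n. \<forall>i<Suc n. i \<noteq> k \<longrightarrow> A $$ (i, 0) = 0")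
      case False
      then obtain i where i: "i < Suc n" "A $$ (i, 0) \<noteq> 0" by blast
      with False obtain j where j: "j < Suc n" "j \<noteq> i" "A $$ (j, 0) \<noteq> 0" by blast
      show thesis
      proof (cases "\<bar>A $$ (i, 0)\<bar> \<le> \<bar>A $$ (j, 0)\<bar>")
        case True
        show thesis by (rule pair[of i j]) (fact i j(1) j(2)[symmetric] j(3) True)+
      next
        case False
        then have "\<bar>A $$ (j, 0)\<bar> \<le> \<bar>A $$ (i, 0)\<bar>" by linarith
        then show thesis by (rule pair[OF j(1) i(1) j(2,3) i(2)])
      qed
    next
      case True
      then show thesis by (elim exE conjE) (rule single)
    qed
    then show ?case
    proof cases
      case (pair i j)
      \<comment> \<open>This multiple of row \<open>i\<close> leaves the remainder in row
        \<open>j\<close>. The remainder is smaller than the entry of row \<open>i\<close>, which by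
        the choice of the pair is at most the old entry of row \<open>j\<close>.\<close>
      define a where "a = - (A $$ (j, 0) div A $$ (i, 0))"
      define B where "B = addrow a j i A"
      have B: "B \<in> carrier_mat (Suc n) (Suc n)" "B = addrow_mat (Suc n) a j i * A"
        using addrow_mat[OF A pair(1)] A by (auto simp: B_def)
      have detU: "det (addrow_mat (Suc n) a j i) = 1" using pair by (simp add: det_addrow_mat)
      have detB: "det B = det A" using pair A by (auto simp: B_def intro!: det_addrow)
      have Bj: "B $$ (j, 0) = A $$ (j, 0) mod A $$ (i, 0)" 
        using A pair unfolding B_def a_def by (simp add: minus_div_mult_eq_mod[symmetric])
      have Bi: "B $$ (l, 0) = A $$ (l, 0)" if "l < Suc n" "l \<noteq> j" for l
        using A pair that by (auto simp: B_def)
      have "\<bar>B $$ (j, 0)\<bar> < \<bar>A $$ (j, 0)\<bar>"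
        using abs_mod_less[OF pair(4), of "A $$ (j, 0)"] pair(6) unfolding Bj by linarith
      moreover from this Bi have le: "nat \<bar>B $$ (l, 0)\<bar> \<le> nat \<bar>A $$ (l, 0)\<bar>" if "l < Suc n" for l
        using that by (cases "l = j") auto
      ultimately have sum_less: "(\<Sum>l<Suc n. nat \<bar>B $$ (l, 0)\<bar>) < (\<Sum>l<Suc n. nat \<bar>A $$ (l, 0)\<bar>)"
        using pair(2) by (intro sum_strict_mono_ex1 ballI bexI[of _ j]) (simp_all only: finite_lessThan lessThan_iff zless_nat_conj simp_thms, linarith?)
      have "row_lattice B = row_lattice A"
        unfolding B(2) by (rule row_lattice_unimodular[OF A]) (simp_all add: detU)
      moreover have "det B \<noteq> 0" using less.prems(2) detB by simp
      ultimately show ?thesis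
        using less.hyps[OF sum_less B(1)] by (simp only: detB simp_thms)
    next
      case (single k)
      show ?thesis
      proof (cases "k = 0")
        case True
        then show ?thesis using cleared[OF less.prems] single by auto
      next
        case False
        define B where "B = swaprows 0 k A"
        have B: "B \<in> carrier_mat (Suc n) (Suc n)" "B = swaprows_mat (Suc n) 0 k * A"
          using swaprows_mat[OF A] single(2) A by (auto simp: B_def)
        have detU: "det (swaprows_mat (Suc n) 0 k) = - 1"
          using single False by (intro det_swaprows_mat) auto
        have detB: "det B = - det A" using det_swaprows[of 0 "Suc n" k A] single False A by (auto simp: B_def)
        have "\<forall>i<n. B $$ (Suc i, 0) = 0"
          using A single False by (auto simp: B_def)
        moreover have "row_lattice B = row_lattice A"
          unfolding B(2) by (rule row_lattice_unimodular[OF A]) (simp_all add: detU)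
        moreover have "det B \<noteq> 0" using less.prems(2) detB by simp
        ultimately show ?thesis
          using cleared[OF B(1)] by (simp add: detB)
      qed
    qed
  qed
qed

section \<open>Transfer of the index along a homomorphism from integer vectors\<close>

lemma row_lattice_diff:
  assumes A: "A \<in> carrier_mat n m" and "a \<in> row_lattice A" "b \<in> row_lattice A"
  shows "a - b \<in> row_lattice A"
proof -
  obtain x y where "x \<in> carrier_vec n" "y \<in> carrier_vec n" "a = transpose_mat A *\<^sub>v x" "b = transpose_mat A *\<^sub>v y"
    using assms by (auto simp: row_lattice_def)
  then show ?thesis
    using A by (auto simp: row_lattice_def mult_minus_distrib_mat_vec[of _ m n] intro!: exI[of _ "x - y"])
qed

lemma row_lattice_carrier:
  assumes "A \<in> carrier_mat n m" "a \<in> row_lattice A"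
  shows "a \<in> carrier_vec m"
  using assms by (auto simp: row_lattice_def intro!: mult_mat_vec_carrier[of _ m n])

lemma row_lattice_add:
  assumes A: "A \<in> carrier_mat n m" and "a \<in> row_lattice A" "b \<in> row_lattice A"
  shows "a + b \<in> row_lattice A"
proof -
  obtain x y where "x \<in> carrier_vec n" "y \<in> carrier_vec n" "a = transpose_mat A *\<^sub>v x" "b = transpose_mat A *\<^sub>v y"
    using assms by (auto simp: row_lattice_def)
  then show ?thesis
    using A by (auto simp: row_lattice_def mult_add_distrib_mat_vec[of _ m n] intro!: exI[of _ "x + y"])
qed

text \<open>The kernel of \<open>\<Phi>\<close> lies inside the lattice, so passing to images merges
  no cosets. The index counted among integer vectors is therefore the index in
  \<open>G\<close>.\<close>

lemma bij_betw_coset_reps_rcosets: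
  fixes \<Phi> :: "int vec \<Rightarrow> 'a" and G :: "('a, 'b) monoid_scheme"
  assumes A: "A \<in> carrier_mat n n"
    and hom: "\<And>a b. a \<in> carrier_vec n \<Longrightarrow> b \<in> carrier_vec n \<Longrightarrow> \<Phi> (a + b) = \<Phi> a \<otimes>\<^bsub>G\<^esub> \<Phi> b"
    and ker: "\<And>a b. a \<in> carrier_vec n \<Longrightarrow> b \<in> carrier_vec n \<Longrightarrow> \<Phi> a = \<Phi> b \<Longrightarrow> a - b \<in> row_lattice A"
    and S: "coset_reps n (row_lattice A) S"
  shows "bij_betw (\<lambda>s. (\<Phi> ` row_lattice A) #>\<^bsub>G\<^esub> \<Phi> s) S
    (rcosets\<^bsub>G\<lparr>carrier := \<Phi> ` carrier_vec n\<rparr>\<^esub> (\<Phi> ` row_lattice A))"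
proof -
  let ?L = "row_lattice A"
  have Sc: "s \<in> carrier_vec n" if "s \<in> S" for s using S that by (auto simp: coset_reps_def)
  have Lc: "l \<in> carrier_vec n" if "l \<in> ?L" for l using row_lattice_carrier[OF A that] .
  have zero: "0\<^sub>v n \<in> ?L" 
    using A by (auto simp: row_lattice_def intro!: exI[of _ "0\<^sub>v n"])
  have coset: "(\<Phi> ` ?L) #>\<^bsub>G\<^esub> \<Phi> v = \<Phi> ` ((\<lambda>l. l + v) ` ?L)" if "v \<in> carrier_vec n" for v
  proof -
    have "(\<Phi> ` ?L) #>\<^bsub>G\<^esub> \<Phi> v = (\<lambda>l. \<Phi> l \<otimes>\<^bsub>G\<^esub> \<Phi> v) ` ?L" by (auto simp: r_coset_def)
    also have "\<dots> = (\<lambda>l. \<Phi> (l + v)) ` ?L" by (intro image_cong refl) (simp add: hom Lc that)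
    finally show ?thesis by (simp only: image_image)
  qed
  have shift: "(\<lambda>l. l + v) ` ?L = (\<lambda>l. l + s) ` ?L"
    if "v \<in> carrier_vec n" "s \<in> carrier_vec n" "v - s \<in> ?L" for v s
  proof -
    have "\<exists>l'\<in>?L. l + v = l' + s" if "l \<in> ?L" for l
      using row_lattice_add[OF A that \<open>v - s \<in> ?L\<close>] \<open>v \<in> _\<close> \<open>s \<in> _\<close> Lc[OF that]
      by (intro bexI[of _ "l + (v - s)"]) (auto intro!: eq_vecI)
    moreover have "\<exists>l'\<in>?L. l + s = l' + v" if "l \<in> ?L" for l
      using row_lattice_diff[OF A that \<open>v - s \<in> ?L\<close>] \<open>v \<in> _\<close> \<open>s \<in> _\<close> Lc[OF that]
      by (intro bexI[of _ "l - (v - s)"]) (auto intro!: eq_vecI)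
    ultimately show ?thesis by (auto simp: image_iff)
  qed
  have rc: "(\<Phi> ` ?L) #>\<^bsub>G\<lparr>carrier := C\<rparr>\<^esub> x = (\<Phi> ` ?L) #>\<^bsub>G\<^esub> x" for C x
    by (simp add: r_coset_def)
  have "inj_on (\<lambda>s. (\<Phi> ` ?L) #>\<^bsub>G\<^esub> \<Phi> s) S"
  proof
    fix s t assume s: "s \<in> S" and t: "t \<in> S" and "(\<Phi> ` ?L) #>\<^bsub>G\<^esub> \<Phi> s = (\<Phi> ` ?L) #>\<^bsub>G\<^esub> \<Phi> t"
    then have "\<Phi> ` ((\<lambda>l. l + s) ` ?L) = \<Phi> ` ((\<lambda>l. l + t) ` ?L)" using coset Sc by simp
    moreover have "\<Phi> s \<in> \<Phi> ` ((\<lambda>l. l + s) ` ?L)"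
      using zero Sc[OF s] by (intro imageI image_eqI[of _ _ "0\<^sub>v n"]) auto
    ultimately obtain l where l: "l \<in> ?L" "\<Phi> s = \<Phi> (l + t)" by auto
    \<comment> \<open>The two images agree up to a lattice vector; the kernel hypothesis lifts this
      to a congruence between \<open>s\<close> and \<open>t\<close> themselves.\<close>
    have sub: "s - (l + t) \<in> ?L" using l Lc Sc[OF s] Sc[OF t] by (intro ker) auto
    have eq: "s - t = (s - (l + t)) + l"
      using Sc[OF s] Sc[OF t] Lc[OF l(1)] by (intro eq_vecI) auto
    have "s - t \<in> ?L" unfolding eq by (rule row_lattice_add[OF A sub l(1)])
    moreover have "s - s \<in> ?L" using zero Sc[OF s] by simp
    ultimately show "s = t" using S s t Sc[OF s] unfolding coset_reps_def by blast
  qed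
  moreover have "(\<lambda>s. (\<Phi> ` ?L) #>\<^bsub>G\<^esub> \<Phi> s) ` S = rcosets\<^bsub>G\<lparr>carrier := \<Phi> ` carrier_vec n\<rparr>\<^esub> (\<Phi> ` ?L)"
  proof -
    have "\<exists>s\<in>S. (\<Phi> ` ?L) #>\<^bsub>G\<^esub> \<Phi> v = (\<Phi> ` ?L) #>\<^bsub>G\<^esub> \<Phi> s" if v: "v \<in> carrier_vec n" for v
    proof -
      obtain s where s: "s \<in> S" "v - s \<in> ?L" using S v unfolding coset_reps_def by blast
      have "(\<Phi> ` ?L) #>\<^bsub>G\<^esub> \<Phi> v = (\<Phi> ` ?L) #>\<^bsub>G\<^esub> \<Phi> s"
        unfolding coset[OF v] coset[OF Sc[OF s(1)]] shift[OF v Sc[OF s(1)] s(2)] ..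
      then show ?thesis using s(1) by blast
    qed
    note rep = this
    have rcosets: "rcosets\<^bsub>G\<lparr>carrier := \<Phi> ` carrier_vec n\<rparr>\<^esub> (\<Phi> ` ?L) =
        (\<lambda>v. (\<Phi> ` ?L) #>\<^bsub>G\<^esub> \<Phi> v) ` carrier_vec n"
      by (auto simp: RCOSETS_def rc)
    show ?thesis unfolding rcosets
    proof (rule equalityI)
      show "(\<lambda>s. (\<Phi> ` ?L) #>\<^bsub>G\<^esub> \<Phi> s) ` S \<subseteq> (\<lambda>s. (\<Phi> ` ?L) #>\<^bsub>G\<^esub> \<Phi> s) ` carrier_vec n" using Sc by (intro image_mono) auto
      show "(\<lambda>s. (\<Phi> ` ?L) #>\<^bsub>G\<^esub> \<Phi> s) ` carrier_vec n \<subseteq> (\<lambda>s. (\<Phi> ` ?L) #>\<^bsub>G\<^esub> \<Phi> s) ` S"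
      proof (rule image_subsetI)
        fix v :: "int vec" assume "v \<in> carrier_vec n"
        then obtain s where "s \<in> S" "(\<Phi> ` ?L) #>\<^bsub>G\<^esub> \<Phi> v = (\<Phi> ` ?L) #>\<^bsub>G\<^esub> \<Phi> s" using rep by blast
        then show "(\<Phi> ` ?L) #>\<^bsub>G\<^esub> \<Phi> v \<in> (\<lambda>s. (\<Phi> ` ?L) #>\<^bsub>G\<^esub> \<Phi> s) ` S" by (intro image_eqI)
      qed
    qed
  qed
  ultimately show ?thesis by (simp add: bij_betw_def)
qed

section \<open>Pfaffians\<close>

text \<open>A permutation matrix if \<open>f\<close> is injective; otherwise two of its rows
  coincide.\<close>

definition select_mat :: "nat \<Rightarrow> (nat \<Rightarrow> nat) \<Rightarrow> 'a :: zero_neq_one mat" where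
  "select_mat p f = mat p p (\<lambda>(i, j). if j = f i then 1 else 0)"

lemma select_mat_mult:
  fixes X :: "'a :: comm_ring_1 mat"
  assumes X: "X \<in> carrier_mat p m" and f: "\<And>i. i < p \<Longrightarrow> f i < p"
  shows "select_mat p f * X = mat p m (\<lambda>(i, j). X $$ (f i, j))"
proof (rule eq_matI)
  fix i j assume "i < dim_row (mat p m (\<lambda>(i, j). X $$ (f i, j)))" "j < dim_col (mat p m (\<lambda>(i, j). X $$ (f i, j)))"
  then have ij: "i < p" "j < m" by auto
  then have "(select_mat p f * X) $$ (i, j) = (\<Sum>l = 0..<p. (if l = f i then 1 else 0) * X $$ (l, j))"
    using X by (simp add: select_mat_def scalar_prod_def)
  also have "\<dots> = (\<Sum>l = 0..<p. if l = f i then X $$ (l, j) else 0)"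
    by (rule sum.cong) auto
  also have "\<dots> = X $$ (f i, j)" using f[OF ij(1)] by simp
  finally show "(select_mat p f * X) $$ (i, j) = mat p m (\<lambda>(i, j). X $$ (f i, j)) $$ (i, j)"
    using ij by simp
qed (use X in \<open>auto simp: select_mat_def\<close>)

lemma permutes_extend:
  assumes "f \<in> {..<p} \<rightarrow>\<^sub>E {..<p}" "inj_on f {..<p::nat}"
  shows "(\<lambda>i. if i < p then f i else i) permutes {0..<p}"
proof (rule bij_imp_permutes)
  have "f ` {..<p} = {..<p}" using assms by (intro endo_inj_surj) auto
  then have "bij_betw f {0..<p} {0..<p}" using assms by (simp add: bij_betw_def atLeast0LessThan)
  then show "bij_betw (\<lambda>i. if i < p then f i else i) {0..<p} {0..<p}"
    by (subst bij_betw_cong[of _ _ f]) auto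
qed auto

text \<open>Only the square matters, because the same selection acts on both halves of the rows and
  the sign of the permutation cancels.\<close>

lemma det_select_mat_squared:
  assumes f: "f \<in> {..<p} \<rightarrow>\<^sub>E {..<p}"
  shows "(det (select_mat p f :: 'a :: comm_ring_1 mat))\<^sup>2 = (if inj_on f {..<p} then 1 else 0)"
proof (cases "inj_on f {..<p}")
  case True
  let ?g = "\<lambda>i. if i < p then f i else i"
  have "select_mat p f = mat p p (\<lambda>(i, j). (1\<^sub>m p :: 'a mat) $$ (?g i, j))"
    using f by (intro eq_matI) (auto simp: select_mat_def PiE_iff)
  then have "det (select_mat p f :: 'a mat) = signof ?g"
    using det_permute_rows[of "1\<^sub>m p :: 'a mat" p ?g] permutes_extend[OF f True] by simp
  then show ?thesis using True by (simp add: sign_def)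
next
  case False
  then obtain i j where ij: "i < p" "j < p" "i \<noteq> j" "f i = f j" by (auto simp: inj_on_def)
  have "det (select_mat p f :: 'a mat) = 0"
    by (rule det_identical_rows[of _ p i j]) (use ij in \<open>auto simp: select_mat_def\<close>)
  then show ?thesis using False by simp
qed

text \<open>These index choices survive in the Pfaffian expansion; their number cancels the
  factorial in the normalisation of \<open>pfaffian\<close>.\<close>

lemma card_PiE_inj_endo:
  "card {f \<in> {..<p} \<rightarrow>\<^sub>E {..<p}. inj_on f {..<p::nat}} = fact p"
proof -
  have "bij_betw (\<lambda>\<pi>. restrict \<pi> {..<p}) {\<pi>. \<pi> permutes {0..<p}} {f \<in> {..<p} \<rightarrow>\<^sub>E {..<p}. inj_on f {..<p}}"
  proof (rule bij_betw_byWitness[where f' = "\<lambda>f i. if i < p then f i else i"])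
    show "\<forall>a\<in>{\<pi>. \<pi> permutes {0..<p}}. (\<lambda>i. if i < p then restrict a {..<p} i else i) = a"
      by (auto simp: fun_eq_iff permutes_def)
    show "\<forall>f\<in>{f \<in> {..<p} \<rightarrow>\<^sub>E {..<p}. inj_on f {..<p}}. restrict (\<lambda>i. if i < p then f i else i) {..<p} = f"
      by (auto simp: fun_eq_iff PiE_iff extensional_def)
    show "(\<lambda>\<pi>. restrict \<pi> {..<p}) ` {\<pi>. \<pi> permutes {0..<p}} \<subseteq> {f \<in> {..<p} \<rightarrow>\<^sub>E {..<p}. inj_on f {..<p}}"
    proof (rule image_subsetI)
      fix \<pi> assume "\<pi> \<in> {\<pi>. \<pi> permutes {0..<p}}"
      then have \<pi>: "\<pi> permutes {..<p}" by (simp add: atLeast0LessThan)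
      have "restrict \<pi> {..<p} \<in> {..<p} \<rightarrow>\<^sub>E {..<p}"
        using permutes_in_image[OF \<pi>] by (intro restrict_PiE_iff[THEN iffD2]) auto
      moreover have "inj_on (restrict \<pi> {..<p}) {..<p}"
        using permutes_inj_on[OF \<pi>] by simp
      ultimately show "restrict \<pi> {..<p} \<in> {f \<in> {..<p} \<rightarrow>\<^sub>E {..<p}. inj_on f {..<p}}" by simp
    qed
    show "(\<lambda>f i. if i < p then f i else i) ` {f \<in> {..<p} \<rightarrow>\<^sub>E {..<p}. inj_on f {..<p}} \<subseteq> {\<pi>. \<pi> permutes {0..<p}}"
      using permutes_extend by auto
  qed
  then have "card {f \<in> {..<p} \<rightarrow>\<^sub>E {..<p}. inj_on f {..<p}} = card {\<pi>. \<pi> permutes {0..<p}}"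
    by (rule bij_betw_same_card[symmetric])
  also have "\<dots> = fact p" by (rule card_permutations) simp_all
  finally show ?thesis .
qed

section \<open>The Pfaffian of a matrix congruent to \<open>J1_mat\<close>\<close>

lemma prod_double: "(\<Prod>l = 0..<2 * p. f l) = (\<Prod>i<p. f (2 * i) * f (2 * i + 1))"
  for f :: "nat \<Rightarrow> 'a :: comm_monoid_mult"
  by (induction p) (auto simp: mult_ac)

text \<open>\<open>pfaffian\<close> pairs position \<open>2 * i\<close> with
  \<open>2 * i + 1\<close>, whereas \<open>J1_mat\<close> pairs \<open>i\<close> with
  \<open>p + i\<close>. This permutation translates between the two orders and accounts for the sign
  in the Pfaffian formula.\<close>

definition interleave :: "nat \<Rightarrow> nat \<Rightarrow> nat" where
  "interleave p i = (if i < p then 2 * i else if i < 2 * p then 2 * (i - p) + 1 else i)"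

lemma interleave_permutes: "interleave p permutes {0..<2 * p}"
proof (rule bij_imp_permutes)
  have "inj_on (interleave p) {0..<2 * p}"
    by (auto simp: inj_on_def interleave_def split: if_splits; presburger)
  moreover from this have "interleave p ` {0..<2 * p} = {0..<2 * p}"
    by (intro endo_inj_surj) (auto simp: interleave_def)
  ultimately show "bij_betw (interleave p) {0..<2 * p} {0..<2 * p}" by (simp add: bij_betw_def)
qed (auto simp: interleave_def)

text \<open>For \<open>A = S\<^sup>T J\<^sub>1 S\<close> one has \<open>A\<^sub>a\<^sub>b = \<Sum>\<^sub>j (x\<^sub>j\<^sub>a y\<^sub>j\<^sub>b - y\<^sub>j\<^sub>a x\<^sub>j\<^sub>b)\<close> with the rows \<open>x\<^sub>j\<close>, \<open>y\<^sub>j\<close> of \<open>S\<close>.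
  The flag selects between the two orders of the pair, with the sign put on the second factor.\<close>

definition first_factor :: "nat \<Rightarrow> 'a mat \<Rightarrow> bool \<Rightarrow> nat \<Rightarrow> nat \<Rightarrow> 'a" where
  "first_factor p S e j a = (if e then S $$ (p + j, a) else S $$ (j, a))"

definition second_factor :: "nat \<Rightarrow> 'a :: ring_1 mat \<Rightarrow> bool \<Rightarrow> nat \<Rightarrow> nat \<Rightarrow> 'a" where
  "second_factor p S e j a = (if e then - S $$ (j, a) else S $$ (p + j, a))"

lemma J1_mat_index:
  assumes "i < 2 * p" "l < 2 * p"
  shows "J1_mat p $$ (i, l) = (if i < p then if l = p + i then 1 else 0 else if l = i - p then - 1 else 0)"
  using assms unfolding J1_mat_def skew_block_def by (subst index_mat_four_block) auto

lemma J1_mult: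
  assumes S: "S \<in> carrier_mat (2 * p) m"
  shows "J1_mat p * S = mat (2 * p) m (\<lambda>(i, a). if i < p then S $$ (p + i, a) else - S $$ (i - p, a))"
proof (rule eq_matI)
  fix i a assume "i < dim_row (mat (2 * p) m (\<lambda>(i, a). if i < p then S $$ (p + i, a) else - S $$ (i - p, a)))"
    "a < dim_col (mat (2 * p) m (\<lambda>(i, a). if i < p then S $$ (p + i, a) else - S $$ (i - p, a)))"
  then have ia: "i < 2 * p" "a < m" by auto
  have J: "dim_row (J1_mat p) = 2 * p" "dim_col (J1_mat p) = 2 * p" by (auto simp: J1_mat_def skew_block_def)
  have "(J1_mat p * S) $$ (i, a) = (\<Sum>l = 0..<2 * p. J1_mat p $$ (i, l) * S $$ (l, a))"
    using S ia J by (simp add: scalar_prod_def)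
  also have "\<dots> = (\<Sum>l = 0..<2 * p. if l = (if i < p then p + i else i - p)
      then (if i < p then S $$ (l, a) else - S $$ (l, a)) else 0)"
    using ia by (intro sum.cong) (auto simp: J1_mat_index)
  also have "\<dots> = (if i < p then S $$ (p + i, a) else - S $$ (i - p, a))"
    using ia by auto
  finally show "(J1_mat p * S) $$ (i, a) =
      mat (2 * p) m (\<lambda>(i, a). if i < p then S $$ (p + i, a) else - S $$ (i - p, a)) $$ (i, a)"
    using ia by simp
qed (use S in \<open>auto simp: J1_mat_def skew_block_def\<close>)

lemma sum_two_halves: "(\<Sum>l = 0..<2 * p. f l) = (\<Sum>j<p. f j + f (p + j))"
  for f :: "nat \<Rightarrow> 'a :: comm_monoid_add"
proof -
  have "(\<Sum>l = 0..<2 * p. f l) = (\<Sum>l = 0..<p. f l) + (\<Sum>l = p..<p + p. f l)"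
    by (subst sum.atLeastLessThan_concat) (auto simp: mult_2)
  also have "(\<Sum>l = p..<p + p. f l) = (\<Sum>j = 0..<p. f (p + j))"
    using sum.shift_bounds_nat_ivl[of f 0 p p] by (simp add: add.commute)
  finally show ?thesis by (simp add: sum.distrib atLeast0LessThan)
qed

text \<open>The flag gives both signed terms one common product shape, so that a product of entries
  can be distributed over functions \<open>f\<close> and \<open>e\<close>.\<close>

lemma congruent_J1_entry:
  assumes S: "S \<in> carrier_mat (2 * p) (2 * p)" and ab: "a < 2 * p" "b < 2 * p"
  shows "(transpose_mat S * J1_mat p * S) $$ (a, b) =
    (\<Sum>j<p. \<Sum>e\<in>UNIV. first_factor p S e j a * second_factor p S e j b)"
proof -
  have J: "J1_mat p \<in> carrier_mat (2 * p) (2 * p)"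
    unfolding J1_mat_def skew_block_def by (auto intro!: carrier_matI)
  have "transpose_mat S * J1_mat p * S = transpose_mat S * (J1_mat p * S)"
    using S J by (intro assoc_mult_mat) auto
  also have "\<dots> $$ (a, b) = (\<Sum>l = 0..<2 * p. S $$ (l, a) * (if l < p then S $$ (p + l, b) else - S $$ (l - p, b)))"
    using S ab by (auto simp: J1_mult[OF S] scalar_prod_def intro!: sum.cong)
  also have "\<dots> = (\<Sum>j<p. \<Sum>e\<in>UNIV. first_factor p S e j a * second_factor p S e j b)"
    unfolding sum_two_halves by (intro sum.cong) (auto simp: first_factor_def second_factor_def UNIV_bool)
  finally show ?thesis .
qed

text \<open>The rows arise from \<open>S\<close> by two multiplications: \<open>K\<close> selects
  the rows \<open>f\<close> in both halves, and \<open>E\<close> turns each flagged pair by a right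
  angle. Hence the flags leave the determinant unchanged, and a repeated choice in \<open>f\<close>
  makes it vanish.\<close>

lemma det_paired_rows:
  fixes S :: "'a :: idom mat"
  assumes S: "S \<in> carrier_mat (2 * p) (2 * p)" and f: "f \<in> {..<p} \<rightarrow>\<^sub>E {..<p}"
  shows "det (mat (2 * p) (2 * p) (\<lambda>(i, a). if i < p then first_factor p S (e i) (f i) a
      else second_factor p S (e (i - p)) (f (i - p)) a)) = (if inj_on f {..<p} then det S else 0)"
    (is "det ?N = _")
proof -
  obtain S1 S2 S3 S4 where split: "split_block S p p = (S1, S2, S3, S4)" by (metis prod_cases4)
  have Sd: "dim_row S = p + p" "dim_col S = p + p" using S by auto
  note Sb = split_block[OF split Sd]
  define X0 where "X0 = (mat_diag p (\<lambda>i. if e i then 0 else 1) :: 'a mat)"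
  define X1 where "X1 = (mat_diag p (\<lambda>i. if e i then 1 else 0) :: 'a mat)"
  define P where "P = (select_mat p f :: 'a mat)"
  have X: "X0 \<in> carrier_mat p p" "X1 \<in> carrier_mat p p" "- X1 \<in> carrier_mat p p"
    and P: "P \<in> carrier_mat p p" by (auto simp: X0_def X1_def P_def select_mat_def)
  have f': "f i < p" if "i < p" for i using f that by auto
  define K where "K = four_block_mat P (0\<^sub>m p p) (0\<^sub>m p p) P"
  define E where "E = four_block_mat X0 X1 (- X1) X0"
  have KS: "K * S = four_block_mat (P * S1) (P * S2) (P * S3) (P * S4)"
    unfolding K_def by (subst Sb(5), subst mult_four_block_mat[OF P _ _ P Sb(1-4)]) (use P Sb in auto)
  have PS: "P * S1 \<in> carrier_mat p p" "P * S2 \<in> carrier_mat p p" "P * S3 \<in> carrier_mat p p" "P * S4 \<in> carrier_mat p p"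
    using P Sb by auto
  have neg: "- X1 = mat_diag p (\<lambda>i. if e i then - 1 else 0)"
    by (intro eq_matI) (auto simp: X1_def mat_diag_def)
  have "?N = E * (K * S)"
  proof (rule eq_matI)
    fix i a assume "i < dim_row (E * (K * S))" "a < dim_col (E * (K * S))"
    then have ia: "i < 2 * p" "a < 2 * p" using X PS Sb(1-4) by (auto simp: E_def KS)
    have Sdims: "dim_row S1 = p" "dim_col S1 = p" "dim_row S4 = p" "dim_col S4 = p" using Sb(1-4) by auto
    have Sidx: "S $$ (i, a) = (if i < p then (if a < p then S1 $$ (i, a) else S2 $$ (i, a - p))
        else (if a < p then S3 $$ (i - p, a) else S4 $$ (i - p, a - p)))" if "i < 2 * p" for i
      by (subst Sb(5), subst index_mat_four_block(1)) (use that ia Sdims in simp_all)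
    have XP: "mat_diag p g * (P * Y) = mat p p (\<lambda>(i, a). g i * Y $$ (f i, a))" if "Y \<in> carrier_mat p p" for g Y
    proof -
      have "P * Y = mat p p (\<lambda>(i, a). Y $$ (f i, a))"
        unfolding P_def by (rule select_mat_mult[OF that]) (rule f')
      then show ?thesis by (auto simp: mat_diag_mult_left[of _ p p] intro!: eq_matI)
    qed
    have prod: "E * (K * S) = four_block_mat (X0 * (P * S1) + X1 * (P * S3)) (X0 * (P * S2) + X1 * (P * S4))
        (- X1 * (P * S1) + X0 * (P * S3)) (- X1 * (P * S2) + X0 * (P * S4))"
      unfolding E_def KS by (rule mult_four_block_mat[OF X(1) X(2) X(3) X(1) PS])
    have fi: "f i < p" if "i < p" using f' that .
    have fip: "f (i - p) < p" if "\<not> i < p" using f'[of "i - p"] that ia by simp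
    show "?N $$ (i, a) = (E * (K * S)) $$ (i, a)"
      unfolding prod neg unfolding X0_def X1_def XP[OF Sb(1)] XP[OF Sb(2)] XP[OF Sb(3)] XP[OF Sb(4)]
      using ia fi fip
      by (cases "i < p"; cases "a < p") (simp_all add: first_factor_def second_factor_def Sidx)
  qed (use X PS Sb(1-4) in \<open>auto simp: E_def KS\<close>)
  \<comment> \<open>The blocks are commuting diagonal matrices, so the determinant is that of
    \<open>X0 * X0 + X1 * X1\<close>. This is the identity, since at each position exactly one of
    the two has entry 1.\<close>
  moreover have "det E = 1"
  proof -
    have "- X1 * X0 = X0 * - X1" "X0 * X0 - X1 * - X1 = 1\<^sub>m p"
      unfolding neg unfolding X0_def X1_def mat_diag_diag by (auto intro!: eq_matI simp: mat_diag_def)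
    then show ?thesis unfolding E_def
      by (subst det_four_block_mat[OF X(1) X(2) X(3) X(1)]) auto
  qed
  moreover have "det K = (if inj_on f {..<p} then 1 else 0)"
    unfolding K_def using det_select_mat_squared[OF f, where 'a = 'a]
    by (subst det_four_block_mat_upper_right_zero[OF P refl _ P]) (auto simp: P_def power2_eq_square)
  moreover have "E \<in> carrier_mat (2 * p) (2 * p)" "K \<in> carrier_mat (2 * p) (2 * p)"
    using X P by (auto simp: E_def K_def mult_2)
  ultimately show ?thesis using S by (simp add: det_mult[of _ "2 * p"])
qed

text \<open>After expansion, the signed sum over \<open>\<sigma>\<close> for fixed \<open>f\<close>
  and \<open>e\<close> is a determinant. All \<open>2 ^ p\<close> flags and all
  \<open>fact p\<close> injective choices contribute the same value, which is exactly the
  normalising denominator.\<close>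

lemma pfaffian_congruent_J1:
  assumes S: "S \<in> carrier_mat (2 * p) (2 * p)"
  shows "pfaffian (transpose_mat S * J1_mat p * S) = sign (interleave p) * det S"
proof -
  let ?A = "transpose_mat S * J1_mat p * S" and ?Per = "{\<sigma>. \<sigma> permutes {0..<2 * p}}"
  let ?F = "{..<p} \<rightarrow>\<^sub>E {..<p}" and ?B = "{..<p} \<rightarrow>\<^sub>E (UNIV :: bool set)"
  \<comment> \<open>Adjacent rows hold the two factors of one pair, which turns the paired product
    into a single Leibniz product over \<open>2 * p\<close> rows.\<close>
  define N where "N f e = mat (2 * p) (2 * p) (\<lambda>(l, a). if even l then first_factor p S (e (l div 2)) (f (l div 2)) a
      else second_factor p S (e (l div 2)) (f (l div 2)) a)" for f e
  have expand: "(\<Prod>i<p. ?A $$ (\<sigma> (2 * i), \<sigma> (2 * i + 1))) =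
      (\<Sum>f\<in>?F. \<Sum>e\<in>?B. \<Prod>l = 0..<2 * p. N f e $$ (l, \<sigma> l))" if \<sigma>: "\<sigma> \<in> ?Per" for \<sigma>
  proof -
    have lt: "\<sigma> l < 2 * p" if "l < 2 * p" for l
      using permutes_in_image[of \<sigma> "{0..<2 * p}" l] \<sigma> that by auto
    have "(\<Prod>i<p. ?A $$ (\<sigma> (2 * i), \<sigma> (2 * i + 1))) =
       (\<Prod>i<p. \<Sum>j<p. \<Sum>e\<in>UNIV. first_factor p S e j (\<sigma> (2 * i)) * second_factor p S e j (\<sigma> (2 * i + 1)))"
      by (intro prod.cong refl congruent_J1_entry[OF S] lt) auto
    also have "\<dots> = (\<Sum>f\<in>?F. \<Sum>e\<in>?B. \<Prod>i<p. first_factor p S (e i) (f i) (\<sigma> (2 * i)) * second_factor p S (e i) (f i) (\<sigma> (2 * i + 1)))"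
      by (simp add: prod_sum_PiE)
    also have "\<dots> = (\<Sum>f\<in>?F. \<Sum>e\<in>?B. \<Prod>l = 0..<2 * p. N f e $$ (l, \<sigma> l))"
      unfolding prod_double by (intro sum.cong prod.cong refl) (auto simp: N_def lt)
    finally show ?thesis .
  qed
  have detN: "det (N f e) = sign (interleave p) * (if inj_on f {..<p} then det S else 0)" if f: "f \<in> ?F" for f e
  proof -
    have "mat (2 * p) (2 * p) (\<lambda>(i, a). N f e $$ (interleave p i, a)) =
      mat (2 * p) (2 * p) (\<lambda>(i, a). if i < p then first_factor p S (e i) (f i) a
      else second_factor p S (e (i - p)) (f (i - p)) a)"
      by (intro eq_matI) (auto simp: N_def interleave_def)
    then have "signof (interleave p) * det (N f e) = (if inj_on f {..<p} then det S else 0)"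
      using det_permute_rows[of "N f e" "2 * p" "interleave p"] interleave_permutes[of p]
        det_paired_rows[OF S f, of e] by (simp add: N_def)
    then show ?thesis by (auto simp: sign_def)
  qed
  have "(\<Sum>\<sigma>\<in>?Per. of_int (sign \<sigma>) * (\<Prod>i<p. ?A $$ (\<sigma> (2 * i), \<sigma> (2 * i + 1)))) =
      (\<Sum>\<sigma>\<in>?Per. \<Sum>f\<in>?F. \<Sum>e\<in>?B. of_int (sign \<sigma>) * (\<Prod>l = 0..<2 * p. N f e $$ (l, \<sigma> l)))"
    by (intro sum.cong refl) (simp only: expand sum_distrib_left)
  also have "\<dots> = (\<Sum>f\<in>?F. \<Sum>\<sigma>\<in>?Per. \<Sum>e\<in>?B. of_int (sign \<sigma>) * (\<Prod>l = 0..<2 * p. N f e $$ (l, \<sigma> l)))"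
    by (rule sum.swap)
  also have "\<dots> = (\<Sum>f\<in>?F. \<Sum>e\<in>?B. det (N f e))"
    by (intro sum.cong refl, subst sum.swap) (auto intro!: sum.cong simp: det_def'[of _ "2 * p"] N_def)
  also have "\<dots> = (\<Sum>f\<in>?F. 2 ^ p * (sign (interleave p) * (if inj_on f {..<p} then det S else 0)))"
    by (intro sum.cong refl) (simp add: detN card_PiE)
  also have "\<dots> = 2 ^ p * sign (interleave p) * (\<Sum>f\<in>?F. if inj_on f {..<p} then det S else 0)"
    by (simp add: sum_distrib_left mult.assoc)
  also have "(\<Sum>f\<in>?F. if inj_on f {..<p} then det S else 0) = fact p * det S"
    by (subst sum.inter_filter[symmetric]) (simp_all add: finite_PiE card_PiE_inj_endo)
  finally show ?thesis
    using S by (simp add: pfaffian_def Let_def)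
qed

section \<open>The reduction map and the phase group\<close>

text \<open>The floor is additive here because the coordinates concerned are integers.\<close>

lemma reduce_mod_add:
  assumes x: "x \<in> lift_space p k" and y: "y \<in> lift_space p k"
  shows "reduce_mod p k c (x + y) = reduce_mod p k c x \<otimes>\<^bsub>phase_group p k c\<^esub> reduce_mod p k c y"
proof -
  have dims: "dim_vec y = 2 * p + 2 * k" using y by (auto simp: lift_space_def)
  have fl: "\<lfloor>(x + y) $ (2 * p + j)\<rfloor> = \<lfloor>x $ (2 * p + j)\<rfloor> + \<lfloor>y $ (2 * p + j)\<rfloor>" if "j < 2 * k" for j
  proof -
    have "x $ (2 * p + j) \<in> \<int>" "y $ (2 * p + j) \<in> \<int>" using x y that by (auto simp: lift_space_def)
    then show ?thesis using that dims by (auto elim!: Ints_cases)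
  qed
  have "vec (2 * p) (\<lambda>i. (x + y) $ i) = vec (2 * p) (\<lambda>i. x $ i) + vec (2 * p) (\<lambda>i. y $ i)"
    using dims by (intro eq_vecI) auto
  moreover have "\<lfloor>(x + y) $ (2 * p + k + j)\<rfloor> = \<lfloor>x $ (2 * p + k + j)\<rfloor> + \<lfloor>y $ (2 * p + k + j)\<rfloor>"
    "\<lfloor>(x + y) $ (2 * p + j)\<rfloor> = \<lfloor>x $ (2 * p + j)\<rfloor> + \<lfloor>y $ (2 * p + j)\<rfloor>" if "j < k" for j
    using fl[of "k + j"] fl[of j] that by (simp_all add: add.assoc)
  ultimately show ?thesis
    by (auto simp: reduce_mod_def phase_group_def residue_prod_def monoid_vec_def mod_add_eq
        fun_eq_iff restrict_def simp del: index_add_vec)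
qed

lemma canonical_lift_in_lift_space:
  assumes "z \<in> carrier (phase_group p k c)"
  shows "canonical_lift k z \<in> lift_space p k"
  using assms by (auto simp: canonical_lift_def lift_space_def phase_group_def monoid_vec_def intro!: carrier_vecI)

text \<open>Residues in the carrier already lie between 0 and \<open>c j\<close>, where reduction
  does nothing.\<close>

lemma reduce_mod_canonical_lift:
  assumes c: "\<forall>j<k. c j > 0" and z: "z \<in> carrier (phase_group p k c)"
  shows "reduce_mod p k c (canonical_lift k z) = z"
proof -
  obtain x u v where zz: "z = (x, u, v)" by (cases z) auto
  have x: "x \<in> carrier_vec (2 * p)" 
    and u: "u \<in> (\<Pi>\<^sub>E j\<in>{..<k}. {0..<int (c j)})" and v: "v \<in> (\<Pi>\<^sub>E j\<in>{..<k}. {0..<int (c j)})"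
    using z c unfolding zz
    by (auto simp: phase_group_def monoid_vec_def residue_prod_def carrier_integer_mod_group PiE_iff split: if_splits)
  have "vec (2 * p) (\<lambda>i. canonical_lift k z $ i) = x"
    using x by (intro eq_vecI) (auto simp: zz canonical_lift_def)
  moreover have "(\<lambda>j\<in>{..<k}. \<lfloor>canonical_lift k z $ (2 * p + j)\<rfloor> mod int (c j)) = u"
    using x u by (auto simp: zz canonical_lift_def fun_eq_iff restrict_def PiE_iff extensional_def)
  moreover have "(\<lambda>j\<in>{..<k}. \<lfloor>canonical_lift k z $ (2 * p + k + j)\<rfloor> mod int (c j)) = v"
    using x v by (auto simp: zz canonical_lift_def fun_eq_iff restrict_def PiE_iff extensional_def)
  ultimately show ?thesis by (simp add: reduce_mod_def zz)
qed

lemma reduce_mod_in_carrier: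
  assumes "\<forall>j<k. c j > 0"
  shows "reduce_mod p k c v \<in> carrier (phase_group p k c)"
  using assms by (auto simp: reduce_mod_def phase_group_def monoid_vec_def residue_prod_def carrier_integer_mod_group)

text \<open>Its columns generate the kernel of the reduction on the integer coordinates; both halves
  of the index range carry the same moduli.\<close>

definition moduli_mat :: "nat \<Rightarrow> (nat \<Rightarrow> nat) \<Rightarrow> int mat" where
  "moduli_mat k c = mat_diag (2 * k) (\<lambda>j. int (c (if j < k then j else j - k)))"

lemma moduli_mat_carrier [simp]: "moduli_mat k c \<in> carrier_mat (2 * k) (2 * k)"
  by (simp add: moduli_mat_def)

lemma mat_diag_mult_vec:
  fixes f :: "nat \<Rightarrow> 'a :: comm_ring_1"
  assumes "q \<in> carrier_vec n" "j < n"
  shows "(mat_diag n f *\<^sub>v q) $ j = f j * q $ j"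
proof -
  have "(mat_diag n f *\<^sub>v q) $ j = (\<Sum>i = 0..<n. (if j = i then f i else 0) * q $ i)"
    using assms by (auto simp: mat_diag_def scalar_prod_def)
  also have "\<dots> = (\<Sum>i = 0..<n. if i = j then f j * q $ j else 0)"
    by (rule sum.cong) auto
  finally show ?thesis using assms by simp
qed

lemma all_less_add_iff:
  fixes a b :: nat
  shows "(\<forall>i<a + b. P i) \<longleftrightarrow> (\<forall>i<a. P i) \<and> (\<forall>j<b. P (a + j))"
proof (intro iffI conjI allI impI)
  fix i assume *: "(\<forall>i<a. P i) \<and> (\<forall>j<b. P (a + j))" and i: "i < a + b"
  show "P i" using * i by (cases "i < a") (auto dest: spec[of _ "i - a"])
qed auto

text \<open>Each coordinate congruence supplies one integer quotient, and these form the vector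
  \<open>q\<close>. Equality in \<open>G\<close> can thus be tested on lifts.\<close>

lemma reduce_mod_eq_iff:
  assumes x: "x \<in> lift_space p k" and y: "y \<in> lift_space p k"
  shows "reduce_mod p k c x = reduce_mod p k c y \<longleftrightarrow>
    (\<exists>q \<in> carrier_vec (2 * k). x = y + (0\<^sub>v (2 * p) @\<^sub>v map_vec real_of_int (moduli_mat k c *\<^sub>v q)))"
proof -
  define cc where "cc j = int (c (if j < k then j else j - k))" for j
  define a where "a j = \<lfloor>x $ (2 * p + j)\<rfloor>" for j
  define b where "b j = \<lfloor>y $ (2 * p + j)\<rfloor>" for j
  have xy: "x $ (2 * p + j) = of_int (a j)" "y $ (2 * p + j) = of_int (b j)" if "j < 2 * k" for j
  proof -
    have "x $ (2 * p + j) \<in> \<int>" "y $ (2 * p + j) \<in> \<int>" using x y that by (auto simp: lift_space_def)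
    then show "x $ (2 * p + j) = of_int (a j)" "y $ (2 * p + j) = of_int (b j)"
      by (auto simp: a_def b_def elim!: Ints_cases)
  qed
  have dims: "dim_vec x = 2 * p + 2 * k" "dim_vec y = 2 * p + 2 * k"
    using x y by (auto simp: lift_space_def)
  have qidx: "(moduli_mat k c *\<^sub>v q) $ j = cc j * q $ j" if "q \<in> carrier_vec (2 * k)" "j < 2 * k" for q j
    unfolding moduli_mat_def cc_def by (rule mat_diag_mult_vec[OF that])
  have split: "(\<forall>j<2 * k. P j) \<longleftrightarrow> (\<forall>j<k. P j) \<and> (\<forall>j<k. P (k + j))" for P :: "nat \<Rightarrow> bool"
    unfolding mult_2 by (rule all_less_add_iff)
  have "reduce_mod p k c x = reduce_mod p k c y \<longleftrightarrow>
      (\<forall>i<2 * p. x $ i = y $ i) \<and> (\<forall>j<2 * k. a j mod cc j = b j mod cc j)"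
    unfolding split by (auto simp: reduce_mod_def vec_eq_iff fun_eq_iff restrict_def a_def b_def cc_def add.assoc)
  also have "(\<forall>j<2 * k. a j mod cc j = b j mod cc j) \<longleftrightarrow> (\<forall>j<2 * k. \<exists>q. a j = b j + cc j * q)"
    by (auto simp: mod_eq_dvd_iff dvd_def algebra_simps)
  also have "\<dots> \<longleftrightarrow> (\<exists>q \<in> carrier_vec (2 * k). \<forall>j<2 * k. a j = b j + cc j * q $ j)"
  proof
    assume "\<forall>j<2 * k. \<exists>q. a j = b j + cc j * q"
    then obtain q where "\<forall>j<2 * k. a j = b j + cc j * q j" by metis
    then show "\<exists>q \<in> carrier_vec (2 * k). \<forall>j<2 * k. a j = b j + cc j * q $ j"
      by (intro bexI[of _ "vec (2 * k) q"]) auto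
  qed auto
  also have "(\<forall>i<2 * p. x $ i = y $ i) \<and> \<dots> \<longleftrightarrow>
    (\<exists>q \<in> carrier_vec (2 * k). x = y + (0\<^sub>v (2 * p) @\<^sub>v map_vec real_of_int (moduli_mat k c *\<^sub>v q)))" (is "_ \<longleftrightarrow> (\<exists>q \<in> _. ?E q)")
  proof -
    have "?E q \<longleftrightarrow> (\<forall>i<2 * p. x $ i = y $ i) \<and> (\<forall>j<2 * k. a j = b j + cc j * q $ j)"
      if q: "q \<in> carrier_vec (2 * k)" for q
    proof -
      let ?w = "y + (0\<^sub>v (2 * p) @\<^sub>v map_vec real_of_int (moduli_mat k c *\<^sub>v q))"
      have dm: "dim_vec (moduli_mat k c *\<^sub>v q) = 2 * k" by (simp add: carrier_matD(1)[OF moduli_mat_carrier])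
      have "?E q \<longleftrightarrow> (\<forall>i<2 * p + 2 * k. x $ i = ?w $ i)"
        using dims dm by (auto simp: vec_eq_iff simp del: index_mult_mat_vec)
      also have "\<dots> \<longleftrightarrow> (\<forall>i<2 * p. x $ i = ?w $ i) \<and> (\<forall>j<2 * k. x $ (2 * p + j) = ?w $ (2 * p + j))"
        by (rule all_less_add_iff)
      also have "(\<forall>i<2 * p. x $ i = ?w $ i) \<longleftrightarrow> (\<forall>i<2 * p. x $ i = y $ i)"
        using dims dm by (simp del: index_mult_mat_vec)
      also have "(\<forall>j<2 * k. x $ (2 * p + j) = ?w $ (2 * p + j)) \<longleftrightarrow> (\<forall>j<2 * k. a j = b j + cc j * q $ j)"
      proof -
        have "?w $ (2 * p + j) = of_int (b j + cc j * q $ j)" if "j < 2 * k" for j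
          using dims dm that xy(2)[OF that] qidx[OF q that] by (simp del: index_mult_mat_vec)
        note w = this
        show ?thesis by (intro all_cong1 imp_cong refl) (simp only: w xy(1) of_int_eq_iff)
      qed
      finally show ?thesis .
    qed
    then show ?thesis by auto
  qed
  finally show ?thesis .
qed

lemma exp_two_pi_i_eq_1_iff:
  "exp (2 * of_real pi * \<i> * of_real r) = (1 :: complex) \<longleftrightarrow> r \<in> \<int>"
proof -
  have "exp (2 * of_real pi * \<i> * of_real r) = cis (2 * pi * r)"
    by (simp add: cis_conv_exp mult_ac)
  moreover have "cis (2 * pi * r) = 1 \<longleftrightarrow> cos (2 * pi * r) = 1"
    using cos_one_sin_zero[of "2 * pi * r"] by (auto simp: complex_eq_iff)
  moreover have "cos (2 * pi * r) = 1 \<longleftrightarrow> (\<exists>n::int. r = of_int n)"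
    unfolding cos_one_2pi_int by auto
  ultimately show ?thesis by (auto simp: Ints_def)
qed

text \<open>Testing against unit vectors suffices. This reduces orthogonality to the whole lattice
  to \<open>n\<close> integrality conditions.\<close>

lemma scalar_prod_Ints_iff:
  fixes g :: "real vec"
  assumes g: "g \<in> carrier_vec n"
  shows "(\<forall>e \<in> carrier_vec n. g \<bullet> map_vec real_of_int e \<in> \<int>) \<longleftrightarrow> (\<forall>i<n. g $ i \<in> \<int>)"
proof (intro iffI allI ballI impI)
  fix i assume H: "\<forall>e \<in> carrier_vec n. g \<bullet> map_vec real_of_int e \<in> \<int>" and i: "i < n"
  have "map_vec real_of_int (unit_vec n i) = unit_vec n i" by (intro eq_vecI) (auto simp: unit_vec_def)
  then show "g $ i \<in> \<int>" using H[rule_format, of "unit_vec n i"] g i by simp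
next
  fix e :: "int vec" assume H: "\<forall>i<n. g $ i \<in> \<int>" and e: "e \<in> carrier_vec n"
  show "g \<bullet> map_vec real_of_int e \<in> \<int>"
    using H g e by (auto simp: scalar_prod_def intro!: Ints_sum Ints_mult)
qed

section \<open>The logical quotient\<close>

abbreviation real_mat :: "int mat \<Rightarrow> real mat" where "real_mat \<equiv> map_mat real_of_int"
abbreviation real_vec :: "int vec \<Rightarrow> real vec" where "real_vec \<equiv> map_vec real_of_int"

lemma real_vec_add:
  assumes "a \<in> carrier_vec m" "b \<in> carrier_vec m"
  shows "real_vec (a + b) = real_vec a + real_vec b"
  using assms by (intro eq_vecI) auto

lemma carrier_vec_add_eq: "carrier_vec (a + b) = {x @\<^sub>v y | x y. x \<in> carrier_vec a \<and> y \<in> carrier_vec b}"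
proof (intro equalityI subsetI)
  fix z :: "'a vec" assume "z \<in> carrier_vec (a + b)"
  then have "z = vec_first z a @\<^sub>v vec_last z b" by simp
  then show "z \<in> {x @\<^sub>v y | x y. x \<in> carrier_vec a \<and> y \<in> carrier_vec b}"
    using vec_first_carrier vec_last_carrier by blast
qed auto

lemma append_vec_add_right:
  fixes x :: "'a :: monoid_add vec"
  assumes "x \<in> carrier_vec a" "y \<in> carrier_vec b" "z \<in> carrier_vec b"
  shows "x @\<^sub>v (y + z) = (x @\<^sub>v y) + (0\<^sub>v a @\<^sub>v z)"
  using assms by (intro eq_vecI) auto

lemma zero_mat_mult_vec: "w \<in> carrier_vec s \<Longrightarrow> 0\<^sub>m r s *\<^sub>v w = (0\<^sub>v r :: 'a :: semiring_0 vec)"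
  by (intro eq_vecI) auto

section \<open>Entries and determinants of the symplectic blocks\<close>

lemma det_skew_block:
  fixes B :: "'a :: idom mat"
  assumes B: "B \<in> carrier_mat r r"
  shows "det (skew_block r B) = (det B)\<^sup>2"
proof -
  have "det (skew_block r B) = det (0\<^sub>m r r * 0\<^sub>m r r - B * (- B))"
    unfolding skew_block_def by (rule det_four_block_mat) (use B in auto)
  also have "0\<^sub>m r r * 0\<^sub>m r r - B * (- B) = B * B"
    using B by (intro eq_matI) (auto simp: scalar_prod_def sum_negf)
  also have "det \<dots> = (det B)\<^sup>2" using B by (simp add: det_mult power2_eq_square)
  finally show ?thesis .
qed

lemma J1_mat_carrier [simp]: "J1_mat p \<in> carrier_mat (2 * p) (2 * p)"
  unfolding J1_mat_def skew_block_def by (auto intro!: carrier_matI)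

lemma J2_mat_carrier [simp]: "J2_mat k c \<in> carrier_mat (2 * k) (2 * k)"
  unfolding J2_mat_def skew_block_def by (auto intro!: carrier_matI simp: mat_diag_def)

text \<open>A symmetric \<open>B\<close> makes the block matrix antisymmetric, so moving it across
  the scalar product costs a sign.\<close>

lemma scalar_prod_skew_block:
  fixes B :: "'a :: comm_ring_1 mat"
  assumes B: "B \<in> carrier_mat r r" "transpose_mat B = B"
    and x: "x \<in> carrier_vec (2 * r)" and y: "y \<in> carrier_vec (2 * r)"
  shows "(skew_block r B *\<^sub>v x) \<bullet> y = - (x \<bullet> (skew_block r B *\<^sub>v y))"
proof -
  have S: "skew_block r B \<in> carrier_mat (2 * r) (2 * r)"
    unfolding skew_block_def mult_2 using B by (intro four_block_carrier_mat) auto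
  have "transpose_mat (skew_block r B) = - skew_block r B"
    unfolding skew_block_def
    by (subst transpose_four_block_mat[of _ r r _ r _ r]) (use B in \<open>auto intro!: eq_matI simp: transpose_uminus\<close>)
  then have "x \<bullet> (skew_block r B *\<^sub>v y) = (- skew_block r B *\<^sub>v x) \<bullet> y"
    using transpose_vec_mult_scalar[OF S y x] by simp
  also have "- skew_block r B *\<^sub>v x = - (skew_block r B *\<^sub>v x)"
    using S x by (intro eq_vecI) auto
  finally show ?thesis using S y by simp
qed

lemma det_J1_mat: "det (J1_mat p) = 1"
  unfolding J1_mat_def by (simp add: det_skew_block[of _ p])

lemma J2_mat_index:
  assumes "i < 2 * k" "l < 2 * k"
  shows "J2_mat k c $$ (i, l) = (if i < k then if l = k + i then 1 / real (c i) else 0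
     else if i = k + l then - 1 / real (c l) else 0)"
proof -
  have "dim_row (mat_diag k (\<lambda>j. 1 / real (c j))) = k" "dim_col (mat_diag k (\<lambda>j. 1 / real (c j))) = k"
    by (auto simp: mat_diag_def)
  then show ?thesis
    using assms unfolding J2_mat_def skew_block_def by (subst index_mat_four_block) (auto simp: mat_diag_def)
qed

lemma skew_block_one_index:
  assumes "i < 2 * k" "l < 2 * k"
  shows "skew_block k (1\<^sub>m k :: 'a :: comm_ring_1 mat) $$ (i, l) = (if i < k then if l = k + i then 1 else 0
     else if i = k + l then - 1 else 0)"
  using assms unfolding skew_block_def by (subst index_mat_four_block) auto

lemma skew_block_one_carrier [simp]: "skew_block k (1\<^sub>m k :: 'a :: comm_ring_1 mat) \<in> carrier_mat (2 * k) (2 * k)"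
  unfolding skew_block_def by (auto intro!: carrier_matI)

text \<open>The moduli cancel the denominators of \<open>J2_mat\<close>; this makes the upper right
  block of \<open>coord_gens\<close> integral.\<close>

lemma J2_mult_moduli_mat:
  assumes "\<forall>j<k. c j > 0"
  shows "J2_mat k c * real_mat (moduli_mat k c) = real_mat (skew_block k (1\<^sub>m k))"
proof -
  have m: "real_mat (moduli_mat k c) = mat_diag (2 * k) (\<lambda>j. real (c (if j < k then j else j - k)))"
    by (intro eq_matI) (auto simp: moduli_mat_def mat_diag_def)
  have dims: "dim_row (skew_block k (1\<^sub>m k :: int mat)) = 2 * k" "dim_col (skew_block k (1\<^sub>m k :: int mat)) = 2 * k"
    by (auto simp: skew_block_def)
  have pos: "c j \<noteq> 0" if "j < k" for j using assms that by auto
  show ?thesis unfolding m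
    by (subst mat_diag_mult_right[of _ "2 * k"])
      (auto intro!: eq_matI simp: pos J2_mat_index skew_block_one_index dims)
qed

lemma det_mat_diag: "det (mat_diag n f :: 'a :: comm_ring_1 mat) = (\<Prod>i<n. f i)"
proof -
  have "det (mat_diag n f) = prod_list (diag_mat (mat_diag n f))"
    by (rule det_upper_triangular[of _ n]) (auto simp: mat_diag_def)
  then show ?thesis
    by (simp add: prod_list_diag_prod atLeast0LessThan) (simp add: mat_diag_def)
qed

lemma prod_two_halves: "(\<Prod>l<2 * k. f l) = (\<Prod>j<k. f j) * (\<Prod>j<k. f (k + j))"
  for f :: "nat \<Rightarrow> 'a :: comm_monoid_mult"
proof -
  have "(\<Prod>l = 0..<2 * k. f l) = (\<Prod>l = 0..<k. f l) * (\<Prod>l = k..<k + k. f l)"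
    by (subst prod.atLeastLessThan_concat) (auto simp: mult_2)
  also have "(\<Prod>l = k..<k + k. f l) = (\<Prod>j = 0..<k. f (k + j))"
    using prod.shift_bounds_nat_ivl[of f 0 k k] by (simp add: add.commute)
  finally show ?thesis by (simp add: atLeast0LessThan)
qed

lemma det_moduli_mat: "det (moduli_mat k c) = (\<Prod>j<k. int (c j))\<^sup>2"
  unfolding moduli_mat_def det_mat_diag prod_two_halves power2_eq_square by simp

section \<open>Integral coordinates for the dual lattice\<close>

context
  fixes p k n :: nat and c :: "nat \<Rightarrow> nat" and T1 :: "real mat" and T2 \<Theta> :: "int mat"
  assumes n: "n = 2 * p"
    and c: "\<forall>j<k. c j > 0"
    and T1: "T1 \<in> carrier_mat n n" "det T1 \<noteq> 0"
    and T2: "T2 \<in> carrier_mat (2 * k) n"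
    and Theta: "\<Theta> \<in> carrier_mat n n"
    and pairing: "transpose_mat T1 * J1_mat p * T1 + transpose_mat (real_mat T2) * J2_mat k c * real_mat T2
      = real_mat \<Theta>"
begin

text \<open>With \<open>mod_form\<close> these are the two column blocks of \<open>T^T J\<close>,
  acting on the continuous and on the integer coordinates.\<close>

definition pos_form :: "real mat" where "pos_form = transpose_mat T1 * J1_mat p"
definition mod_form :: "real mat" where "mod_form = transpose_mat (real_mat T2) * J2_mat k c"

text \<open>\<open>dual_coords\<close> sends \<open>(x, w)\<close> to \<open>(T\<^sup>T J (x, w), w)\<close>, so the lifts of points of the dual
  lattice are exactly the preimages of integer vectors.\<close>

definition dual_coords :: "real mat" where
  "dual_coords = four_block_mat pos_form mod_form (0\<^sub>m (2 * k) n) (1\<^sub>m (2 * k))"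

text \<open>The inverse of \<open>dual_coords\<close> by the adjugate formula; the determinant
  divided by is \<open>det T1\<close>, hence nonzero.\<close>

definition from_coords :: "real mat" where
  "from_coords = inverse (det dual_coords) \<cdot>\<^sub>m adj_mat dual_coords"

text \<open>The columns are lifted generators of \<open>D\<close> followed by generators of the
  kernel of the reduction; together they span all lifts of points of \<open>D\<close>.\<close>

definition lift_gens :: "real mat" where
  "lift_gens = four_block_mat T1 (0\<^sub>m n (2 * k)) (real_mat T2) (real_mat (moduli_mat k c))"

text \<open>The columns of \<open>lift_gens\<close> in the dual coordinates, given directly by
  integer blocks so that the index count for integer matrices applies.\<close>

definition coord_gens :: "int mat" where
  "coord_gens = four_block_mat \<Theta> (transpose_mat T2 * skew_block k (1\<^sub>m k)) T2 (moduli_mat k c)"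

definition point :: "int vec \<Rightarrow> phase_point" where
  "point v = reduce_mod p k c (from_coords *\<^sub>v real_vec v)"

lemma pos_mod_form_carrier: "pos_form \<in> carrier_mat n n" "mod_form \<in> carrier_mat n (2 * k)"
  using T1 T2 n by (auto simp: pos_form_def mod_form_def intro!: mult_carrier_mat[of _ n n] mult_carrier_mat[of _ n "2 * k"])

lemma det_pos_form: "det pos_form = det T1"
  unfolding pos_form_def using T1 n det_J1_mat[of p] by (simp add: det_mult[of _ n] det_transpose[of _ n])

lemma dual_coords_carrier: "dual_coords \<in> carrier_mat (n + 2 * k) (n + 2 * k)"
  using pos_mod_form_carrier by (simp add: dual_coords_def)

lemma det_dual_coords: "det dual_coords = det T1"
  unfolding dual_coords_def using pos_mod_form_carrier
  by (subst det_four_block_mat_lower_left_zero[of _ n _ "2 * k"]) (auto simp: det_pos_form)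

lemma from_coords_carrier: "from_coords \<in> carrier_mat (n + 2 * k) (n + 2 * k)"
  using adj_mat(1)[OF dual_coords_carrier] by (simp add: from_coords_def)

lemma coords_inverse:
  "dual_coords * from_coords = 1\<^sub>m (n + 2 * k)" "from_coords * dual_coords = 1\<^sub>m (n + 2 * k)"
proof -
  note adj = adj_mat[OF dual_coords_carrier]
  have nz: "det dual_coords \<noteq> 0" using T1 by (simp add: det_dual_coords)
  have "dual_coords * from_coords = inverse (det dual_coords) \<cdot>\<^sub>m (dual_coords * adj_mat dual_coords)"
    unfolding from_coords_def by (rule mult_smult_distrib[OF dual_coords_carrier adj(1)])
  then show "dual_coords * from_coords = 1\<^sub>m (n + 2 * k)"
    using nz unfolding adj(2) by (auto intro!: eq_matI)
  have "from_coords * dual_coords = inverse (det dual_coords) \<cdot>\<^sub>m (adj_mat dual_coords * dual_coords)"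
    unfolding from_coords_def by (rule mult_smult_assoc_mat[OF adj(1) dual_coords_carrier])
  then show "from_coords * dual_coords = 1\<^sub>m (n + 2 * k)"
    using nz unfolding adj(3) by (auto intro!: eq_matI)
qed

lemma from_dual_coords: "z \<in> carrier_vec (n + 2 * k) \<Longrightarrow> from_coords *\<^sub>v (dual_coords *\<^sub>v z) = z"
  by (simp only: assoc_mult_mat_vec[OF from_coords_carrier dual_coords_carrier, symmetric] coords_inverse(2) one_mult_mat_vec)

lemma dual_from_coords: "z \<in> carrier_vec (n + 2 * k) \<Longrightarrow> dual_coords *\<^sub>v (from_coords *\<^sub>v z) = z"
  by (simp only: assoc_mult_mat_vec[OF dual_coords_carrier from_coords_carrier, symmetric] coords_inverse(1) one_mult_mat_vec)

lemma dual_coords_append: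
  assumes "x \<in> carrier_vec n" "w \<in> carrier_vec (2 * k)"
  shows "dual_coords *\<^sub>v (x @\<^sub>v w) = (pos_form *\<^sub>v x + mod_form *\<^sub>v w) @\<^sub>v w"
proof -
  have "0\<^sub>m (2 * k) n *\<^sub>v x + 1\<^sub>m (2 * k) *\<^sub>v w = w" using assms by (intro eq_vecI) auto
  then show ?thesis
    unfolding dual_coords_def using assms pos_mod_form_carrier
    by (subst four_block_mat_mult_vec[of _ n n _ "2 * k" _ "2 * k"]) auto
qed

lemma coord_gens_carrier: "coord_gens \<in> carrier_mat (n + 2 * k) (n + 2 * k)"
  using Theta by (simp add: coord_gens_def)

lemma lift_gens_carrier: "lift_gens \<in> carrier_mat (n + 2 * k) (n + 2 * k)"
  using T1 by (simp add: lift_gens_def)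

text \<open>Here the hypothesis \<open>pairing\<close> enters: it makes the upper left block
  integral, while the cancellation of the moduli takes care of the upper right one.\<close>

lemma coord_gens_factor: "real_mat coord_gens = dual_coords * lift_gens"
proof -
  have T2': "real_mat T2 \<in> carrier_mat (2 * k) n" using T2 by simp
  have M: "real_mat (moduli_mat k c) \<in> carrier_mat (2 * k) (2 * k)" by simp
  have b1: "pos_form * T1 + mod_form * real_mat T2 = real_mat \<Theta>" using pairing by (simp add: pos_form_def mod_form_def)
  have "mod_form * real_mat (moduli_mat k c) = transpose_mat (real_mat T2) * (J2_mat k c * real_mat (moduli_mat k c))"
    unfolding mod_form_def using T2 by (intro assoc_mult_mat[of _ n "2 * k" _ "2 * k" _ "2 * k"]) auto
  also have "\<dots> = transpose_mat (real_mat T2) * real_mat (skew_block k (1\<^sub>m k))"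
    by (simp add: J2_mult_moduli_mat[OF c])
  also have "\<dots> = real_mat (transpose_mat T2 * skew_block k (1\<^sub>m k))"
    unfolding map_mat_transpose using T2 by (intro of_int_hom.mat_hom_mult[symmetric, of _ n "2 * k" _ "2 * k"]) auto
  finally have b2: "pos_form * 0\<^sub>m n (2 * k) + mod_form * real_mat (moduli_mat k c) = real_mat (transpose_mat T2 * skew_block k (1\<^sub>m k))"
    using pos_mod_form_carrier T2 by (simp add: left_add_zero_mat[of _ n "2 * k"])
  have b3: "0\<^sub>m (2 * k) n * T1 + 1\<^sub>m (2 * k) * real_mat T2 = real_mat T2" 
    using T1 T2 by (simp add: left_add_zero_mat[of _ "2 * k" n])
  have b4: "0\<^sub>m (2 * k) n * 0\<^sub>m n (2 * k) + 1\<^sub>m (2 * k) * real_mat (moduli_mat k c) = real_mat (moduli_mat k c)"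
    by (simp add: left_mult_one_mat[OF M] left_add_zero_mat[OF M])
  have "dual_coords * lift_gens = four_block_mat (real_mat \<Theta>) (real_mat (transpose_mat T2 * skew_block k (1\<^sub>m k)))
      (real_mat T2) (real_mat (moduli_mat k c))"
    unfolding dual_coords_def lift_gens_def
    by (subst mult_four_block_mat[OF pos_mod_form_carrier zero_carrier_mat one_carrier_mat T1(1) zero_carrier_mat T2' M])
      (simp only: b1 b2 b3 b4)
  also have "\<dots> = real_mat coord_gens"
    unfolding coord_gens_def using Theta T2
    by (intro map_four_block_mat[symmetric, of _ n n _ "2 * k" _ "2 * k"]) auto
  finally show ?thesis by simp
qed

text \<open>\<open>T1\<close> contributes once through the coordinate change and once through the
  generators, and each \<open>c j\<close> occurs twice among the moduli. So the index is a perfect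
  square.\<close>

lemma det_coord_gens: "real_of_int (det coord_gens) = (det T1)\<^sup>2 * (\<Prod>j<k. real (c j))\<^sup>2"
proof -
  have "real_of_int (det coord_gens) = det dual_coords * det lift_gens"
    unfolding of_int_hom.hom_det[symmetric] coord_gens_factor
    by (rule det_mult[OF dual_coords_carrier lift_gens_carrier])
  also have "det lift_gens = det T1 * det (real_mat (moduli_mat k c))"
    unfolding lift_gens_def by (rule det_four_block_mat_upper_right_zero[of _ n _ "2 * k"]) (use T1 T2 in auto)
  finally show ?thesis
    by (simp add: det_dual_coords det_moduli_mat power2_eq_square)
qed

text \<open>\<open>dual_coords\<close> leaves the last \<open>2 * k\<close> coordinates alone, so
  the preimage of an integer vector is an admissible lift.\<close>

lemma from_coords_lift:
  assumes v: "v \<in> carrier_vec (n + 2 * k)"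
  shows "from_coords *\<^sub>v real_vec v \<in> lift_space p k"
    "dual_coords *\<^sub>v (from_coords *\<^sub>v real_vec v) = real_vec v"
proof -
  let ?z = "from_coords *\<^sub>v real_vec v"
  have z: "?z \<in> carrier_vec (n + 2 * k)"
    using from_coords_carrier v by (intro mult_mat_vec_carrier) auto
  show eq: "dual_coords *\<^sub>v ?z = real_vec v"
    using v by (intro dual_from_coords) auto
  obtain x w where xw: "?z = x @\<^sub>v w" "x \<in> carrier_vec n" "w \<in> carrier_vec (2 * k)"
    by (rule that[OF vec_first_last_append[OF z, symmetric] vec_first_carrier vec_last_carrier])
  have eq': "(pos_form *\<^sub>v x + mod_form *\<^sub>v w) @\<^sub>v w = real_vec v"
    using eq dual_coords_append[OF xw(2,3)] unfolding xw(1) by simp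
  have d: "dim_vec (pos_form *\<^sub>v x + mod_form *\<^sub>v w) = n" using pos_mod_form_carrier by simp
  have "?z $ (2 * p + j) \<in> \<int>" if "j < 2 * k" for j
  proof -
    have "?z $ (2 * p + j) = ((pos_form *\<^sub>v x + mod_form *\<^sub>v w) @\<^sub>v w) $ (n + j)"
      unfolding xw(1) using xw(2,3) that n d by (simp del: index_add_vec index_mult_mat_vec)
    also have "\<dots> \<in> \<int>" unfolding eq' using v that by simp
    finally show ?thesis .
  qed
  then show "?z \<in> lift_space p k" using z n by (simp add: lift_space_def)
qed

lemma point_add:
  assumes "a \<in> carrier_vec (n + 2 * k)" "b \<in> carrier_vec (n + 2 * k)"
  shows "point (a + b) = point a \<otimes>\<^bsub>phase_group p k c\<^esub> point b"
proof -
  have "from_coords *\<^sub>v real_vec (a + b) = from_coords *\<^sub>v real_vec a + from_coords *\<^sub>v real_vec b"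
    unfolding real_vec_add[OF assms]
    by (rule mult_add_distrib_mat_vec[OF from_coords_carrier]) (use assms in auto)
  then show ?thesis
    unfolding point_def using reduce_mod_add[OF from_coords_lift(1) from_coords_lift(1)] assms by simp
qed

lemma from_coords_gens:
  assumes "e \<in> carrier_vec n" "q \<in> carrier_vec (2 * k)"
  shows "from_coords *\<^sub>v real_vec (coord_gens *\<^sub>v (e @\<^sub>v q)) =
    (T1 *\<^sub>v real_vec e) @\<^sub>v (real_mat T2 *\<^sub>v real_vec e + real_vec (moduli_mat k c *\<^sub>v q))"
proof -
  have eq: "real_vec (e @\<^sub>v q) = real_vec e @\<^sub>v real_vec q" by (intro eq_vecI) auto
  have l: "lift_gens *\<^sub>v real_vec (e @\<^sub>v q) \<in> carrier_vec (n + 2 * k)"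
    using lift_gens_carrier assms by (intro mult_mat_vec_carrier[of _ _ "n + 2 * k"]) auto
  have "real_vec (coord_gens *\<^sub>v (e @\<^sub>v q)) = real_mat coord_gens *\<^sub>v real_vec (e @\<^sub>v q)"
    by (rule of_int_hom.mult_mat_vec_hom[OF coord_gens_carrier]) (use assms in auto)
  also have "\<dots> = dual_coords *\<^sub>v (lift_gens *\<^sub>v real_vec (e @\<^sub>v q))"
    unfolding coord_gens_factor using dual_coords_carrier lift_gens_carrier assms
    by (intro assoc_mult_mat_vec) auto
  finally have "from_coords *\<^sub>v real_vec (coord_gens *\<^sub>v (e @\<^sub>v q)) = lift_gens *\<^sub>v real_vec (e @\<^sub>v q)"
    using from_dual_coords[OF l] by simp
  also have "\<dots> = (T1 *\<^sub>v real_vec e + 0\<^sub>m n (2 * k) *\<^sub>v real_vec q) @\<^sub>v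
      (real_mat T2 *\<^sub>v real_vec e + real_mat (moduli_mat k c) *\<^sub>v real_vec q)"
    unfolding eq lift_gens_def using T1 T2 assms
    by (intro four_block_mat_mult_vec[of _ n n _ "2 * k" _ "2 * k"]) auto
  also have "T1 *\<^sub>v real_vec e + 0\<^sub>m n (2 * k) *\<^sub>v real_vec q = T1 *\<^sub>v real_vec e"
    using T1 assms by (intro eq_vecI) auto
  also have "real_mat (moduli_mat k c) *\<^sub>v real_vec q = real_vec (moduli_mat k c *\<^sub>v q)"
    by (rule of_int_hom.mult_mat_vec_hom[symmetric, OF moduli_mat_carrier assms(2)])
  finally show ?thesis .
qed

text \<open>Transposed because \<open>row_lattice\<close> combines rows, whereas the generators are
  the columns of \<open>coord_gens\<close>.\<close>

abbreviation L :: "int vec set" where "L \<equiv> row_lattice (transpose_mat coord_gens)"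

lemma L_eq: "L = {coord_gens *\<^sub>v (e @\<^sub>v q) | e q. e \<in> carrier_vec n \<and> q \<in> carrier_vec (2 * k)}"
proof -
  have "L = {coord_gens *\<^sub>v z | z. z \<in> carrier_vec (n + 2 * k)}"
    unfolding row_lattice_def using coord_gens_carrier by simp
  then show ?thesis unfolding carrier_vec_add_eq by blast
qed

lemma lattice_vec_in_lift_space:
  assumes e: "e \<in> carrier_vec n"
  shows "(T1 @\<^sub>r real_mat T2) *\<^sub>v real_vec e = (T1 *\<^sub>v real_vec e) @\<^sub>v real_vec (T2 *\<^sub>v e)"
    "(T1 *\<^sub>v real_vec e) @\<^sub>v real_vec (T2 *\<^sub>v e) \<in> lift_space p k"
proof -
  have "(T1 @\<^sub>r real_mat T2) *\<^sub>v real_vec e = (T1 *\<^sub>v real_vec e) @\<^sub>v (real_mat T2 *\<^sub>v real_vec e)"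
    using T1 T2 e by (intro mat_mult_append[of _ n n _ "2 * k"]) auto
  then show "(T1 @\<^sub>r real_mat T2) *\<^sub>v real_vec e = (T1 *\<^sub>v real_vec e) @\<^sub>v real_vec (T2 *\<^sub>v e)"
    unfolding of_int_hom.mult_mat_vec_hom[OF T2 e] .
  have d: "dim_vec (T1 *\<^sub>v real_vec e) = 2 * p" "dim_vec (T2 *\<^sub>v e) = 2 * k" using T1 T2 n by auto
  have "((T1 *\<^sub>v real_vec e) @\<^sub>v real_vec (T2 *\<^sub>v e)) $ (2 * p + j) \<in> \<int>" if "j < 2 * k" for j
    using d that by (simp del: index_mult_mat_vec)
  then show "(T1 *\<^sub>v real_vec e) @\<^sub>v real_vec (T2 *\<^sub>v e) \<in> lift_space p k"
    using d by (auto simp: lift_space_def intro!: carrier_vecI)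
qed

text \<open>The component \<open>q\<close> only adds multiples of the moduli and disappears in
  \<open>G\<close>.\<close>

lemma point_gens:
  assumes e: "e \<in> carrier_vec n" and q: "q \<in> carrier_vec (2 * k)"
  shows "point (coord_gens *\<^sub>v (e @\<^sub>v q)) = reduce_mod p k c ((T1 *\<^sub>v real_vec e) @\<^sub>v real_vec (T2 *\<^sub>v e))"
proof -
  let ?y = "(T1 *\<^sub>v real_vec e) @\<^sub>v real_vec (T2 *\<^sub>v e)"
  have d: "T1 *\<^sub>v real_vec e \<in> carrier_vec (2 * p)" "T2 *\<^sub>v e \<in> carrier_vec (2 * k)" "moduli_mat k c *\<^sub>v q \<in> carrier_vec (2 * k)"
    using T1 T2 n e q by (auto intro!: mult_mat_vec_carrier[of _ _ n] mult_mat_vec_carrier[of _ _ "2 * k"])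
  have "from_coords *\<^sub>v real_vec (coord_gens *\<^sub>v (e @\<^sub>v q)) = ?y + (0\<^sub>v (2 * p) @\<^sub>v real_vec (moduli_mat k c *\<^sub>v q))"
    unfolding from_coords_gens[OF e q] of_int_hom.mult_mat_vec_hom[OF T2 e, symmetric]
    by (rule append_vec_add_right[of _ _ _ "2 * k"]) (use d in auto)
  moreover have "from_coords *\<^sub>v real_vec (coord_gens *\<^sub>v (e @\<^sub>v q)) \<in> lift_space p k"
    using coord_gens_carrier e q
    by (intro from_coords_lift(1) mult_mat_vec_carrier[of _ _ "n + 2 * k"]) auto
  ultimately show ?thesis
    unfolding point_def using reduce_mod_eq_iff[OF _ lattice_vec_in_lift_space(2)[OF e]] q by blast
qed

lemma lattice_image_alt: "lattice_image p k c n (T1 @\<^sub>r real_mat T2) =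
    (\<lambda>e. reduce_mod p k c ((T1 *\<^sub>v real_vec e) @\<^sub>v real_vec (T2 *\<^sub>v e))) ` carrier_vec n"
  unfolding lattice_image_def Setcompr_eq_image image_image
  by (intro image_cong refl) (simp only: lattice_vec_in_lift_space(1))

lemma lattice_image_eq: "lattice_image p k c n (T1 @\<^sub>r real_mat T2) = point ` L"
proof (intro equalityI subsetI)
  fix x assume "x \<in> lattice_image p k c n (T1 @\<^sub>r real_mat T2)"
  then obtain e where e: "e \<in> carrier_vec n"
    "x = reduce_mod p k c ((T1 *\<^sub>v real_vec e) @\<^sub>v real_vec (T2 *\<^sub>v e))"
    unfolding lattice_image_alt by blast
  then have "x = point (coord_gens *\<^sub>v (e @\<^sub>v 0\<^sub>v (2 * k)))" by (simp only: point_gens zero_carrier_vec)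
  moreover have "coord_gens *\<^sub>v (e @\<^sub>v 0\<^sub>v (2 * k)) \<in> L"
    unfolding L_eq using e(1) zero_carrier_vec by blast
  ultimately show "x \<in> point ` L" by (rule image_eqI)
next
  fix x assume "x \<in> point ` L"
  then obtain e q where "e \<in> carrier_vec n" "q \<in> carrier_vec (2 * k)" "x = point (coord_gens *\<^sub>v (e @\<^sub>v q))"
    unfolding L_eq by blast
  then show "x \<in> lattice_image p k c n (T1 @\<^sub>r real_mat T2)"
    unfolding lattice_image_alt by (intro image_eqI[of _ _ e]) (simp_all only: point_gens)
qed

text \<open>\<open>point\<close> need not be injective, but two lifts of one point differ by a
  vector in the kernel of the reduction. In dual coordinates this is the combination of generators
  with \<open>e = 0\<close>, so it lies in \<open>L\<close>.\<close>

lemma point_kernel: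
  assumes a: "a \<in> carrier_vec (n + 2 * k)" and b: "b \<in> carrier_vec (n + 2 * k)" and ab: "point a = point b"
  shows "a - b \<in> L"
proof -
  obtain q where q: "q \<in> carrier_vec (2 * k)"
    and eq: "from_coords *\<^sub>v real_vec a = from_coords *\<^sub>v real_vec b + (0\<^sub>v (2 * p) @\<^sub>v real_vec (moduli_mat k c *\<^sub>v q))"
    using ab reduce_mod_eq_iff[OF from_coords_lift(1)[OF a] from_coords_lift(1)[OF b]] by (auto simp: point_def)
  let ?l = "coord_gens *\<^sub>v (0\<^sub>v n @\<^sub>v q)"
  have l: "?l \<in> carrier_vec (n + 2 * k)"
    using coord_gens_carrier q by (intro mult_mat_vec_carrier[of _ _ "n + 2 * k"]) auto
  have m: "moduli_mat k c *\<^sub>v q \<in> carrier_vec (2 * k)" using q by (auto intro!: mult_mat_vec_carrier[of _ _ "2 * k"])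
  have "T1 *\<^sub>v real_vec (0\<^sub>v n) = 0\<^sub>v (2 * p)" "real_mat T2 *\<^sub>v real_vec (0\<^sub>v n) = 0\<^sub>v (2 * k)"
    using T1 T2 n by (auto intro!: eq_vecI simp: scalar_prod_def)
  then have "from_coords *\<^sub>v real_vec ?l = 0\<^sub>v (2 * p) @\<^sub>v real_vec (moduli_mat k c *\<^sub>v q)"
    using from_coords_gens[OF zero_carrier_vec q] m by simp
  moreover have a': "real_vec a \<in> carrier_vec (n + 2 * k)" and bl: "real_vec b + real_vec ?l \<in> carrier_vec (n + 2 * k)"
    using a b l by (simp_all del: index_mult_mat_vec)
  ultimately have "from_coords *\<^sub>v real_vec a = from_coords *\<^sub>v (real_vec b + real_vec ?l)"
    using eq b l by (simp add: mult_add_distrib_mat_vec[OF from_coords_carrier])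
  then have "dual_coords *\<^sub>v (from_coords *\<^sub>v real_vec a) = dual_coords *\<^sub>v (from_coords *\<^sub>v (real_vec b + real_vec ?l))"
    by (rule arg_cong)
  then have "real_vec a = real_vec b + real_vec ?l"
    unfolding dual_from_coords[OF a'] dual_from_coords[OF bl] .
  also have "\<dots> = real_vec (b + ?l)" by (rule real_vec_add[symmetric, OF b l])
  finally have "a = b + ?l" by (rule of_int_hom.vec_hom_inj)
  moreover have "b + x - b = x" if "x \<in> carrier_vec (n + 2 * k)" for x
    using b that by (intro eq_vecI) auto
  ultimately have "a - b = ?l" using l by simp
  then show ?thesis unfolding L_eq using q zero_carrier_vec[of n] by blast
qed

text \<open>Antisymmetry moves \<open>J\<close> onto \<open>z\<close>, and transposition then moves
  \<open>T\<close> there as well. What is left is \<open>T^T J z\<close>, the first \<open>n\<close>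
  dual coordinates; this is what dictates the upper blocks of \<open>dual_coords\<close>.\<close>

lemma pairing_lattice:
  assumes z: "z \<in> carrier_vec (n + 2 * k)" and e: "e \<in> carrier_vec n"
  shows "z \<bullet> (J_mat p k c *\<^sub>v ((T1 *\<^sub>v real_vec e) @\<^sub>v real_vec (T2 *\<^sub>v e))) =
     - (vec_first (dual_coords *\<^sub>v z) n \<bullet> real_vec e)"
proof -
  obtain x w where xw: "z = x @\<^sub>v w" "x \<in> carrier_vec n" "w \<in> carrier_vec (2 * k)"
    by (rule that[OF vec_first_last_append[OF z, symmetric] vec_first_carrier vec_last_carrier])
  define a where "a = T1 *\<^sub>v real_vec e"
  define b where "b = real_mat T2 *\<^sub>v real_vec e"
  have e': "real_vec e \<in> carrier_vec n" and T2': "real_mat T2 \<in> carrier_mat (2 * k) n" using e T2 by auto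
  have a: "a \<in> carrier_vec n" and b: "b \<in> carrier_vec (2 * k)" and b_eq: "real_vec (T2 *\<^sub>v e) = b"
    unfolding a_def b_def using mult_mat_vec_carrier[OF T1(1) e'] mult_mat_vec_carrier[OF T2' e']
    unfolding of_int_hom.mult_mat_vec_hom[OF T2 e] by auto
  have J1: "J1_mat p \<in> carrier_mat n n" and J2: "J2_mat k c \<in> carrier_mat (2 * k) (2 * k)" using n by auto
  note Jx = mult_mat_vec_carrier[OF J1 xw(2)] and Jw = mult_mat_vec_carrier[OF J2 xw(3)]
  note Ja = mult_mat_vec_carrier[OF J1 a] and Jb = mult_mat_vec_carrier[OF J2 b]
  have "J_mat p k c *\<^sub>v (a @\<^sub>v b) =
      (J1_mat p *\<^sub>v a + 0\<^sub>m n (2 * k) *\<^sub>v b) @\<^sub>v (0\<^sub>m (2 * k) n *\<^sub>v a + J2_mat k c *\<^sub>v b)"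
    unfolding J_mat_def n[symmetric] using J1 J2 a b
    by (intro four_block_mat_mult_vec[of _ n n _ "2 * k" _ "2 * k"]) auto
  also have "J1_mat p *\<^sub>v a + 0\<^sub>m n (2 * k) *\<^sub>v b = J1_mat p *\<^sub>v a"
    unfolding zero_mat_mult_vec[OF b] by (rule right_zero_vec[OF Ja])
  also have "0\<^sub>m (2 * k) n *\<^sub>v a + J2_mat k c *\<^sub>v b = J2_mat k c *\<^sub>v b"
    unfolding zero_mat_mult_vec[OF a] by (rule left_zero_vec[OF Jb])
  finally have "z \<bullet> (J_mat p k c *\<^sub>v (a @\<^sub>v b)) = x \<bullet> (J1_mat p *\<^sub>v a) + w \<bullet> (J2_mat k c *\<^sub>v b)"
    unfolding xw(1) using scalar_prod_append[OF xw(2,3) Ja Jb] by simp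
  also have "x \<bullet> (J1_mat p *\<^sub>v a) = - ((J1_mat p *\<^sub>v x) \<bullet> a)"
    unfolding J1_mat_def using scalar_prod_skew_block[of "1\<^sub>m p" p x a] xw(2) a n by simp
  also have "(J1_mat p *\<^sub>v x) \<bullet> a = (pos_form *\<^sub>v x) \<bullet> real_vec e"
    unfolding a_def pos_form_def using transpose_vec_mult_scalar[OF T1(1) e' Jx] T1 J1 xw(2) by simp
  also have "w \<bullet> (J2_mat k c *\<^sub>v b) = - ((J2_mat k c *\<^sub>v w) \<bullet> b)"
  proof -
    have "transpose_mat (mat_diag k (\<lambda>j. 1 / real (c j))) = mat_diag k (\<lambda>j. 1 / real (c j))"
      by (intro eq_matI) (auto simp: mat_diag_def)
    then show ?thesis
      unfolding J2_mat_def using scalar_prod_skew_block[of "mat_diag k (\<lambda>j. 1 / real (c j))" k w b] xw(3) b by simp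
  qed
  also have "(J2_mat k c *\<^sub>v w) \<bullet> b = (mod_form *\<^sub>v w) \<bullet> real_vec e"
  proof -
    have "mod_form *\<^sub>v w = transpose_mat (real_mat T2) *\<^sub>v (J2_mat k c *\<^sub>v w)"
      unfolding mod_form_def by (rule assoc_mult_mat_vec[of _ n "2 * k" _ "2 * k"]) (use T2' J2 xw(3) in auto)
    then show ?thesis unfolding b_def using transpose_vec_mult_scalar[OF T2' e' Jw] by simp
  qed
  also have "- ((pos_form *\<^sub>v x) \<bullet> real_vec e) + - ((mod_form *\<^sub>v w) \<bullet> real_vec e) = - ((pos_form *\<^sub>v x + mod_form *\<^sub>v w) \<bullet> real_vec e)"
    using add_scalar_prod_distrib[of "pos_form *\<^sub>v x" n "mod_form *\<^sub>v w" "real_vec e"] pos_mod_form_carrier xw e' by simp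
  also have "pos_form *\<^sub>v x + mod_form *\<^sub>v w = vec_first (dual_coords *\<^sub>v z) n"
    unfolding xw(1) dual_coords_append[OF xw(2,3)] vec_first_def using pos_mod_form_carrier xw
    by (intro eq_vecI) (auto simp del: index_mult_mat_vec)
  finally show ?thesis unfolding a_def b_eq .
qed

text \<open>Orthogonality to \<open>D\<close> is integrality of the first \<open>n\<close> dual
  coordinates. The remaining ones are the integer coordinates of the lift itself and impose no
  condition.\<close>

lemma dual_lattice_eq:
  "dual_lattice p k c (lattice_image p k c n (T1 @\<^sub>r real_mat T2)) = point ` carrier_vec (n + 2 * k)"
proof -
  let ?D = "lattice_image p k c n (T1 @\<^sub>r real_mat T2)"
  have orth: "(\<forall>y\<in>?D. rho p k c (reduce_mod p k c z) y = 1) \<longleftrightarrow> (\<forall>i<n. (dual_coords *\<^sub>v z) $ i \<in> \<int>)"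
    if z: "z \<in> lift_space p k" for z
  proof -
    let ?g = "vec_first (dual_coords *\<^sub>v z) n"
    have zc: "z \<in> carrier_vec (n + 2 * k)" using z n by (simp add: lift_space_def)
    have "rho p k c (reduce_mod p k c z) (reduce_mod p k c ((T1 *\<^sub>v real_vec e) @\<^sub>v real_vec (T2 *\<^sub>v e))) = 1
      \<longleftrightarrow> ?g \<bullet> real_vec e \<in> \<int>" if e: "e \<in> carrier_vec n" for e
      unfolding rho_reduce_mod[OF c z lattice_vec_in_lift_space(2)[OF e]] rho_lift_def pairing_lattice[OF zc e]
        exp_two_pi_i_eq_1_iff by (simp add: minus_in_Ints_iff)
    then have "(\<forall>y\<in>?D. rho p k c (reduce_mod p k c z) y = 1) \<longleftrightarrow> (\<forall>e\<in>carrier_vec n. ?g \<bullet> real_vec e \<in> \<int>)"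
      unfolding lattice_image_alt by (simp only: ball_simps cong: ball_cong)
    also have "\<dots> \<longleftrightarrow> (\<forall>i<n. ?g $ i \<in> \<int>)" by (rule scalar_prod_Ints_iff) simp
    finally show ?thesis by (simp add: vec_first_def)
  qed
  show ?thesis
  proof (intro equalityI subsetI)
    fix z assume "z \<in> dual_lattice p k c ?D"
    then have z: "z \<in> carrier (phase_group p k c)" and zD: "\<forall>y\<in>?D. rho p k c z y = 1"
      by (auto simp: dual_lattice_def)
    let ?z = "canonical_lift k z"
    note lift = canonical_lift_in_lift_space[OF z] and red = reduce_mod_canonical_lift[OF c z]
    have zc: "?z \<in> carrier_vec (n + 2 * k)" using lift n by (simp add: lift_space_def)
    have first: "\<forall>i<n. (dual_coords *\<^sub>v ?z) $ i \<in> \<int>"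
      using orth[OF lift] zD by (simp add: red)
    obtain x w where xw: "?z = x @\<^sub>v w" "x \<in> carrier_vec n" "w \<in> carrier_vec (2 * k)"
      by (rule that[OF vec_first_last_append[OF zc, symmetric] vec_first_carrier vec_last_carrier])
    have d: "dim_vec (pos_form *\<^sub>v x + mod_form *\<^sub>v w) = n" using pos_mod_form_carrier by simp
    have last: "(dual_coords *\<^sub>v ?z) $ (n + j) \<in> \<int>" if "j < 2 * k" for j
    proof -
      have "(dual_coords *\<^sub>v ?z) $ (n + j) = ?z $ (2 * p + j)"
        using xw that n d dual_coords_append[OF xw(2,3)] by (simp del: index_add_vec index_mult_mat_vec)
      then show ?thesis using lift that by (simp add: lift_space_def)
    qed
    have all: "(dual_coords *\<^sub>v ?z) $ i \<in> \<int>" if "i < n + 2 * k" for i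
      using first last[of "i - n"] that by (cases "i < n") auto
    \<comment> \<open>All these coordinates are integers by \<open>all\<close>, so the floor only
      changes the type.\<close>
    define v where "v = vec (n + 2 * k) (\<lambda>i. \<lfloor>(dual_coords *\<^sub>v ?z) $ i\<rfloor>)"
    have "real_vec v = dual_coords *\<^sub>v ?z"
      using all dual_coords_carrier
      by (intro eq_vecI) (auto simp: v_def simp del: index_mult_mat_vec elim!: Ints_cases)
    then have "point v = z" using from_dual_coords[OF zc] red by (simp add: point_def)
    moreover have "v \<in> carrier_vec (n + 2 * k)" by (simp add: v_def)
    ultimately show "z \<in> point ` carrier_vec (n + 2 * k)" by blast
  next
    fix z assume "z \<in> point ` carrier_vec (n + 2 * k)"
    then obtain v where v: "v \<in> carrier_vec (n + 2 * k)" "z = point v" by auto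
    have "\<forall>i<n. (dual_coords *\<^sub>v (from_coords *\<^sub>v real_vec v)) $ i \<in> \<int>"
      unfolding from_coords_lift(2)[OF v(1)] using v(1) by simp
    then show "z \<in> dual_lattice p k c ?D"
      using orth[OF from_coords_lift(1)[OF v(1)]] reduce_mod_in_carrier[OF c]
      by (simp add: dual_lattice_def v(2) point_def)
  qed
qed

theorem order_logical_quotient:
  fixes D
  defines "D \<equiv> lattice_image p k c n (T1 @\<^sub>r real_mat T2)"
  shows "finite (carrier (logical_quotient p k c D))"
    "real (order (logical_quotient p k c D)) = (det T1 * (\<Prod>j<k. real (c j)))\<^sup>2"
proof -
  let ?A = "transpose_mat coord_gens" and ?G = "phase_group p k c"
  have A: "?A \<in> carrier_mat (n + 2 * k) (n + 2 * k)" using coord_gens_carrier by simp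
  have detA: "det ?A = det coord_gens" by (rule det_transpose[OF coord_gens_carrier])
  have "(\<Prod>j<k. real (c j)) \<noteq> 0" using c by auto
  then have "real_of_int (det coord_gens) \<noteq> 0" using T1 by (simp add: det_coord_gens)
  then obtain S where S: "coset_reps (n + 2 * k) L S" "finite S" "card S = nat \<bar>det ?A\<bar>"
    using ex_coset_reps[OF A] detA by auto
  have "bij_betw (\<lambda>s. (point ` L) #>\<^bsub>?G\<^esub> point s) S
    (rcosets\<^bsub>?G\<lparr>carrier := point ` carrier_vec (n + 2 * k)\<rparr>\<^esub> (point ` L))"
    by (rule bij_betw_coset_reps_rcosets[OF A point_add point_kernel S(1)])
  moreover have "carrier (logical_quotient p k c D) =
      rcosets\<^bsub>?G\<lparr>carrier := point ` carrier_vec (n + 2 * k)\<rparr>\<^esub> (point ` L)"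
    unfolding logical_quotient_def D_def dual_lattice_eq unfolding lattice_image_eq by (simp add: FactGroup_def)
  ultimately have bij: "bij_betw (\<lambda>s. (point ` L) #>\<^bsub>?G\<^esub> point s) S (carrier (logical_quotient p k c D))"
    by simp
  show "finite (carrier (logical_quotient p k c D))"
    using bij_betw_finite[OF bij] S(2) by simp
  have "real (order (logical_quotient p k c D)) = \<bar>real_of_int (det coord_gens)\<bar>"
    using bij_betw_same_card[OF bij] S(3) by (simp add: order_def detA)
  also have "\<dots> = (det T1 * (\<Prod>j<k. real (c j)))\<^sup>2"
    by (simp add: det_coord_gens power_mult_distrib)
  finally show "real (order (logical_quotient p k c D)) = (det T1 * (\<Prod>j<k. real (c j)))\<^sup>2" .
qed

end

section \<open>The symplectic normal forms\<close>

text \<open>A single rectangular diagonal matrix replaces the nested blocks, which is the shape that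
  \<open>diag_congruence\<close> treats.\<close>

lemma T2_mat_eq:
  assumes "2 * k \<le> n"
  shows "T2_mat n k d R = mat (2 * k) n (\<lambda>(i, j). if i = j then if i < k then d i else 1 else 0) * R"
proof -
  have dims: "dim_row (mat_diag k d) = k" "dim_col (mat_diag k d) = k" by (auto simp: mat_diag_def)
  show ?thesis
    unfolding T2_mat_def
    by (rule arg_cong[of _ _ "\<lambda>E. E * R"], rule eq_matI) (use assms in \<open>auto simp: dims mat_diag_def\<close>)
qed

lemma diag_congruence:
  fixes X :: "'a :: comm_ring_1 mat" and f :: "nat \<Rightarrow> 'a"
  assumes X: "X \<in> carrier_mat r r" and rn: "r \<le> n"
  defines "E \<equiv> mat r n (\<lambda>(i, j). if i = j then f i else 0)"
  shows "transpose_mat E * X * E = mat n n (\<lambda>(a, b). if a < r \<and> b < r then f a * X $$ (a, b) * f b else 0)"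
proof -
  have E: "E \<in> carrier_mat r n" by (simp add: E_def)
  have "transpose_mat E * X = mat n r (\<lambda>(a, b). if a < r then f a * X $$ (a, b) else 0)"
  proof (rule eq_matI)
    fix a b assume "a < dim_row (mat n r (\<lambda>(a, b). if a < r then f a * X $$ (a, b) else 0))"
      "b < dim_col (mat n r (\<lambda>(a, b). if a < r then f a * X $$ (a, b) else 0))"
    then have ab: "a < n" "b < r" by auto
    then have "(transpose_mat E * X) $$ (a, b) = (\<Sum>i = 0..<r. (if i = a then f i else 0) * X $$ (i, b))"
      using X by (simp add: E_def scalar_prod_def)
    also have "\<dots> = (\<Sum>i = 0..<r. if i = a then f a * X $$ (a, b) else 0)" by (rule sum.cong) auto
    finally show "(transpose_mat E * X) $$ (a, b) = mat n r (\<lambda>(a, b). if a < r then f a * X $$ (a, b) else 0) $$ (a, b)"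
      using ab by simp
  qed (use X E in auto)
  moreover have "mat n r (\<lambda>(a, b). if a < r then f a * X $$ (a, b) else 0) * E =
      mat n n (\<lambda>(a, b). if a < r \<and> b < r then f a * X $$ (a, b) * f b else 0)" (is "?Y * E = ?Z")
  proof (rule eq_matI)
    fix a b assume "a < dim_row ?Z" "b < dim_col ?Z"
    then have ab: "a < n" "b < n" by auto
    then have "(?Y * E) $$ (a, b) = (\<Sum>i = 0..<r. (if a < r then f a * X $$ (a, i) else 0) * (if i = b then f i else 0))"
      by (simp add: E_def scalar_prod_def)
    also have "\<dots> = (\<Sum>i = 0..<r. if i = b then (if a < r then f a * X $$ (a, b) * f b else 0) else 0)"
      by (rule sum.cong) auto
    finally show "(?Y * E) $$ (a, b) = ?Z $$ (a, b)" using ab by simp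
  qed (use E in auto)
  ultimately show ?thesis by simp
qed

lemma transpose_congruence_mult:
  fixes E R X :: "'a :: comm_semiring_0 mat"
  assumes E: "E \<in> carrier_mat r n" and R: "R \<in> carrier_mat n n" and X: "X \<in> carrier_mat r r"
  shows "transpose_mat (E * R) * X * (E * R) = transpose_mat R * (transpose_mat E * X * E) * R"
proof -
  have tE: "transpose_mat E \<in> carrier_mat n r" and tR: "transpose_mat R \<in> carrier_mat n n" using E R by auto
  have "transpose_mat (E * R) * X * (E * R) = (transpose_mat R * transpose_mat E) * X * (E * R)"
    by (simp only: transpose_mult[OF E R])
  also have "\<dots> = (transpose_mat R * (transpose_mat E * X)) * (E * R)"
    by (simp only: assoc_mult_mat[OF tR tE X])
  also have "\<dots> = transpose_mat R * (transpose_mat E * X) * E * R"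
    by (rule assoc_mult_mat[symmetric, OF _ E R]) (use tE tR X in auto)
  also have "transpose_mat R * (transpose_mat E * X) * E = transpose_mat R * (transpose_mat E * X * E)"
    by (rule assoc_mult_mat[OF tR _ E]) (use tE X in auto)
  finally show ?thesis .
qed

text \<open>In lowest terms the denominator divides the squared numerator, to which it is
  coprime.\<close>

lemma square_in_Ints_imp_Ints:
  fixes x :: real
  assumes "x \<in> \<rat>" "x\<^sup>2 \<in> \<int>"
  shows "x \<in> \<int>"
proof -
  obtain a b :: int where b: "b > 0" and x: "x = of_int a / of_int b" and cop: "coprime a b"
    using assms(1) by (rule Rats_cases')
  obtain q where "x\<^sup>2 = of_int q" using assms(2) by (elim Ints_cases)
  then have "real_of_int (a\<^sup>2) = real_of_int (q * b\<^sup>2)"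
    using b by (simp add: x power_divide field_simps)
  then have "a\<^sup>2 = q * b\<^sup>2" by linarith
  then have "b dvd a\<^sup>2" by (simp add: power2_eq_square)
  moreover have "coprime (a\<^sup>2) b" using cop by simp
  ultimately have "is_unit b" using coprime_common_divisor[of "a\<^sup>2" b b] dvd_refl by blast
  then have "b = 1" using b by auto
  then show ?thesis by (simp add: x)
qed

text \<open>Divisibility serves two rings at once: over \<open>int\<close> the determinant has
  absolute value 1, over \<open>real\<close> it is nonzero.\<close>

lemma det_invertible_mat:
  fixes A :: "'a :: comm_ring_1 mat"
  assumes A: "A \<in> carrier_mat n n" and inv: "invertible_mat A"
  shows "det A dvd 1"
proof -
  obtain B where B: "inverts_mat A B" "inverts_mat B A" using inv by (auto simp: invertible_mat_def)
  have eq: "A * B = 1\<^sub>m n" "B * A = 1\<^sub>m (dim_row B)" using A B by (auto simp: inverts_mat_def)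
  have "dim_col B = n" using arg_cong[OF eq(1), of dim_col] by simp
  moreover have "dim_row B = n" using arg_cong[OF eq(2), of dim_col] A by simp
  ultimately have "B \<in> carrier_mat n n" by auto
  then have "det A * det B = 1" using det_mult[OF A, of B] eq(1) by simp
  then show ?thesis using dvdI[of 1 "det A" "det B"] by simp
qed

text \<open>The factors \<open>d\<close> sit in only one half of \<open>T2_mat\<close>, so each
  nonzero entry of the pulled-back form carries one of them: up to sign it is
  \<open>d j / c j = h j / m\<close>. The congruence by \<open>R\<close> then reproduces the normal
  form of \<open>Z\<close>.\<close>

lemma logical_form_pairing:
  fixes m :: nat and Z :: "rat mat"
  assumes k: "2 * k \<le> n" and m: "m > 0" and Z: "Z \<in> carrier_mat n n" and R: "R \<in> carrier_mat n n"
    and normal: "of_nat m \<cdot>\<^sub>m Z = map_mat rat_of_int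
          (transpose_mat R *
           four_block_mat (skew_block k (mat_diag k (\<lambda>j. int (h j)))) (0\<^sub>m (2 * k) (n - 2 * k))
             (0\<^sub>m (n - 2 * k) (2 * k)) (0\<^sub>m (n - 2 * k) (n - 2 * k)) * R)"
    and cd: "\<forall>j<k. c j > 0 \<and> rat_of_nat (h j) / rat_of_nat m = rat_of_int (d j) / rat_of_nat (c j)"
  shows "transpose_mat (real_mat (T2_mat n k d R)) * J2_mat k c * real_mat (T2_mat n k d R) = map_mat real_of_rat Z"
proof -
  define f where "f i = (if i < k then d i else 1)" for i
  define E where "E = mat (2 * k) n (\<lambda>(i, j). if i = j then real_of_int (f i) else 0)"
  define H where "H = four_block_mat (skew_block k (mat_diag k (\<lambda>j. int (h j)))) (0\<^sub>m (2 * k) (n - 2 * k))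
             (0\<^sub>m (n - 2 * k) (2 * k)) (0\<^sub>m (n - 2 * k) (n - 2 * k))"
  have dims: "dim_row (mat_diag k (\<lambda>j. int (h j))) = k" "dim_col (mat_diag k (\<lambda>j. int (h j))) = k"
    by (auto simp: mat_diag_def)
  have Hc: "H \<in> carrier_mat n n"
    using k by (auto simp: H_def skew_block_def dims intro!: carrier_matI)
  have Ec: "E \<in> carrier_mat (2 * k) n" by (simp add: E_def)
  have Rc: "real_mat R \<in> carrier_mat n n" using R by simp
  have T2: "real_mat (T2_mat n k d R) = E * real_mat R"
  proof -
    have "real_mat (T2_mat n k d R) = real_mat (mat (2 * k) n (\<lambda>(i, j). if i = j then f i else 0)) * real_mat R"
      unfolding T2_mat_eq[OF k] f_def by (rule of_int_hom.mat_hom_mult[OF mat_carrier R])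
    also have "real_mat (mat (2 * k) n (\<lambda>(i, j). if i = j then f i else 0)) = E"
      unfolding E_def by (intro eq_matI) auto
    finally show ?thesis .
  qed
  have hd: "real (h j) / real m = real_of_int (d j) / real (c j)" if "j < k" for j
  proof -
    have "real_of_rat (rat_of_nat (h j) / rat_of_nat m) = real_of_rat (rat_of_int (d j) / rat_of_nat (c j))"
      using cd that by simp
    then show ?thesis by (simp add: of_rat_divide)
  qed
  have EJE: "transpose_mat E * J2_mat k c * E = (1 / real m) \<cdot>\<^sub>m real_mat H"
    unfolding E_def diag_congruence[OF J2_mat_carrier k]
  proof (rule eq_matI)
    fix a b assume "a < dim_row ((1 / real m) \<cdot>\<^sub>m real_mat H)" "b < dim_col ((1 / real m) \<cdot>\<^sub>m real_mat H)"
    then have ab: "a < n" "b < n" using Hc by auto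
    have skew: "skew_block k (mat_diag k (\<lambda>j. int (h j))) $$ (a, b) =
      (if a < k then if b = k + a then int (h a) else 0 else if a = k + b then - int (h b) else 0)"
      if "a < 2 * k" "b < 2 * k"
      using that unfolding skew_block_def by (subst index_mat_four_block) (auto simp: dims mat_diag_def)
    have sd: "dim_row (skew_block k (mat_diag k (\<lambda>j. int (h j)))) = 2 * k"
      "dim_col (skew_block k (mat_diag k (\<lambda>j. int (h j)))) = 2 * k"
      by (auto simp: skew_block_def dims)
    have Hidx: "H $$ (a, b) = (if a < 2 * k \<and> b < 2 * k
        then (if a < k then if b = k + a then int (h a) else 0 else if a = k + b then - int (h b) else 0) else 0)"
      using ab k unfolding H_def by (subst index_mat_four_block) (auto simp: sd skew)
    show "mat n n (\<lambda>(a, b). if a < 2 * k \<and> b < 2 * k then real_of_int (f a) * J2_mat k c $$ (a, b) * real_of_int (f b) else 0)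
        $$ (a, b) = ((1 / real m) \<cdot>\<^sub>m real_mat H) $$ (a, b)"
    proof (cases "a < 2 * k \<and> b < 2 * k")
      case True
      then show ?thesis
        using ab Hc hd[of a] hd[of b] by (auto simp: Hidx J2_mat_index f_def)
    qed (use ab Hc in \<open>auto simp: Hidx\<close>)
  qed (use Hc in auto)
  have "transpose_mat (real_mat (T2_mat n k d R)) * J2_mat k c * real_mat (T2_mat n k d R) =
      transpose_mat (real_mat R) * ((1 / real m) \<cdot>\<^sub>m real_mat H) * real_mat R"
    unfolding T2 transpose_congruence_mult[OF Ec Rc J2_mat_carrier] EJE ..
  also have "\<dots> = (1 / real m) \<cdot>\<^sub>m (transpose_mat (real_mat R) * real_mat H * real_mat R)"
    using Rc Hc by (simp add: mult_smult_distrib[of _ n n _ n] mult_smult_assoc_mat[of _ n n _ n])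
  also have "transpose_mat (real_mat R) * real_mat H * real_mat R = real_mat (transpose_mat R * H * R)"
    unfolding map_mat_transpose using R Hc
    by (simp add: of_int_hom.mat_hom_mult[of _ n n _ n])
  also have "(1 / real m) \<cdot>\<^sub>m real_mat (transpose_mat R * H * R) = map_mat real_of_rat Z"
  proof (rule eq_matI)
    fix a b assume "a < dim_row (map_mat real_of_rat Z)" "b < dim_col (map_mat real_of_rat Z)"
    then have ab: "a < n" "b < n" using Z by auto
    have "(of_nat m \<cdot>\<^sub>m Z) $$ (a, b) = rat_of_int ((transpose_mat R * H * R) $$ (a, b))"
      unfolding normal H_def[symmetric] by (rule index_map_mat(1)) (use ab R in auto)
    then have "real_of_rat (of_nat m * Z $$ (a, b)) = real_of_rat (rat_of_int ((transpose_mat R * H * R) $$ (a, b)))"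
      using ab Z by simp
    then have e: "real m * real_of_rat (Z $$ (a, b)) = real_of_int ((transpose_mat R * H * R) $$ (a, b))"
      by (simp only: of_rat_mult of_rat_of_nat_eq of_rat_of_int_eq)
    have "real_of_rat (Z $$ (a, b)) = real_of_int ((transpose_mat R * H * R) $$ (a, b)) / real m"
      unfolding e[symmetric] using m by simp
    moreover have "((1 / real m) \<cdot>\<^sub>m real_mat (transpose_mat R * H * R)) $$ (a, b) =
        real_of_int ((transpose_mat R * H * R) $$ (a, b)) / real m"
      using ab R by (simp del: index_mult_mat(1))
    ultimately show "((1 / real m) \<cdot>\<^sub>m real_mat (transpose_mat R * H * R)) $$ (a, b) = map_mat real_of_rat Z $$ (a, b)"
      using ab Z by (simp del: index_mult_mat(1))
  qed (use R Z in auto)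
  finally show ?thesis .
qed

theorem mainTheorem2:
  fixes n p k m :: nat
    and Z :: "rat mat" and \<Theta> R Q :: "int mat" and T1 T :: "real mat"
    and h t c :: "nat \<Rightarrow> nat" and d :: "nat \<Rightarrow> int"
    and D :: "phase_point set" and K :: real
  assumes p: "p \<ge> 1" and n: "n = 2 * p"
    and Z: "Z \<in> carrier_mat n n" "antisym_mat Z"
    and Theta: "\<Theta> \<in> carrier_mat n n" "antisym_mat \<Theta>"
    and inv: "invertible_mat (map_mat rat_of_int \<Theta> - Z)"
    and m: "m > 0" "\<forall>i<n. \<forall>j<n. of_nat m * Z $$ (i, j) \<in> \<int>"
    and R: "R \<in> carrier_mat n n" "invertible_mat R"
    and Q: "Q \<in> carrier_mat n n" "invertible_mat Q"
    and k: "2 * k \<le> n"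
    and h: "\<forall>j<k. h j > 0" "\<forall>j. Suc j < k \<longrightarrow> h j dvd h (Suc j)"
    and t: "\<forall>j<p. t j > 0" "\<forall>j. Suc j < p \<longrightarrow> t j dvd t (Suc j)"
    and normal_Z: "of_nat m \<cdot>\<^sub>m Z = map_mat rat_of_int
          (transpose_mat R *
           four_block_mat (skew_block k (mat_diag k (\<lambda>j. int (h j)))) (0\<^sub>m (2 * k) (n - 2 * k))
             (0\<^sub>m (n - 2 * k) (2 * k)) (0\<^sub>m (n - 2 * k) (n - 2 * k)) * R)"
    and normal_Theta_Z: "of_nat m \<cdot>\<^sub>m (map_mat rat_of_int \<Theta> - Z) = map_mat rat_of_int
          (transpose_mat Q * skew_block p (mat_diag p (\<lambda>j. int (t j))) * Q)"
    and cd: "\<forall>j<k. c j > 0 \<and> coprime (d j) (int (c j)) \<and>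
          rat_of_nat (h j) / rat_of_nat m = rat_of_int (d j) / rat_of_nat (c j)"
    and T1: "T1 \<in> carrier_mat n n" "invertible_mat T1"
          "transpose_mat T1 * J1_mat p * T1 = map_mat real_of_rat (map_mat rat_of_int \<Theta> - Z)"
    and T: "T = T1 @\<^sub>r map_mat real_of_int (T2_mat n k d R)"
    and D: "D = lattice_image p k c n T"
    and K: "K \<ge> 0" "K\<^sup>2 = real (order (logical_quotient p k c D))"
  shows "finite (carrier (logical_quotient p k c D))
    \<and> K = \<bar>pfaffian (map_mat real_of_rat (map_mat rat_of_int \<Theta> - Z))\<bar>
            * det (mat_diag k (\<lambda>j. real (c j)))
    \<and> K = det (mat_diag k (\<lambda>j. real (c j))) * det (mat_diag p (\<lambda>j. real (t j))) / real m ^ p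
    \<and> K \<in> \<int>"
proof -
  let ?A = "map_mat rat_of_int \<Theta> - Z" and ?c = "\<Prod>j<k. real (c j)" and ?t = "\<Prod>j<p. real (t j)"
  define B where "B = skew_block p (mat_diag p (\<lambda>j. int (t j)))"
  have B: "B \<in> carrier_mat n n"
    unfolding B_def skew_block_def n by (auto intro!: carrier_matI simp: mat_diag_def)
  have A: "?A \<in> carrier_mat n n" using Theta Z by auto
  have cpos: "\<forall>j<k. c j > 0" using cd by blast
  have "T2_mat n k d R \<in> carrier_mat (2 * k) n"
    unfolding T2_mat_eq[OF k] using R by auto
  moreover have "det T1 \<noteq> 0" using det_invertible_mat[OF T1(1,2)] by auto
  moreover have "transpose_mat T1 * J1_mat p * T1 + transpose_mat (real_mat (T2_mat n k d R)) * J2_mat k c *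
      real_mat (T2_mat n k d R) = real_mat \<Theta>"
  proof -
    have "\<forall>j<k. c j > 0 \<and> rat_of_nat (h j) / rat_of_nat m = rat_of_int (d j) / rat_of_nat (c j)" using cd by blast
    then have "transpose_mat (real_mat (T2_mat n k d R)) * J2_mat k c * real_mat (T2_mat n k d R) = map_mat real_of_rat Z"
      by (rule logical_form_pairing[OF k m(1) Z(1) R(1) normal_Z])
    \<comment> \<open>The rational parts cancel between \<open>\<Theta> - Z\<close> from the
      continuous coordinates and \<open>Z\<close> from the residues.\<close>
    then show ?thesis
      unfolding T1(3) using Theta Z by (auto intro!: eq_matI simp: of_rat_diff)
  qed
  ultimately have fin: "finite (carrier (logical_quotient p k c D))"
    and K2: "K\<^sup>2 = (det T1 * ?c)\<^sup>2"
    using order_logical_quotient[OF n cpos T1(1) _ _ Theta(1)] K(2) unfolding D T by auto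
  have c0: "?c > 0" using cd by (intro prod_pos) auto
  have t0: "?t > 0" using t by (intro prod_pos) auto
  have K_eq: "K = \<bar>det T1\<bar> * ?c"
    using power2_eq_imp_eq[of K "\<bar>det T1\<bar> * ?c"] K(1) K2 c0 by (simp add: power_mult_distrib)
  \<comment> \<open>The sign of \<open>interleave\<close> disappears under the absolute
    value.\<close>
  have pf: "\<bar>pfaffian (map_mat real_of_rat ?A)\<bar> = \<bar>det T1\<bar>"
    unfolding T1(3)[symmetric] using pfaffian_congruent_J1[of T1 p] T1(1) n by (simp add: abs_mult sign_def)
  \<comment> \<open>Both sides equal \<open>det (\<Theta> - Z)\<close>: on the left because
    \<open>J1_mat\<close> has determinant 1, on the right by the normal form, where
    \<open>det Q\<close> squares to 1 and \<open>m ^ n\<close> is the square of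
    \<open>m ^ p\<close>.\<close>
  have "(det T1)\<^sup>2 = (?t / real m ^ p)\<^sup>2"
  proof -
    have detQ: "(det Q)\<^sup>2 = 1"
    proof -
      have "\<bar>det Q\<bar> = 1" using det_invertible_mat[OF Q] by simp
      then have "\<bar>det Q\<bar>\<^sup>2 = 1" by simp
      then show ?thesis by simp
    qed
    have "of_nat m ^ n * det ?A = rat_of_int (det (transpose_mat Q * B * Q))"
      using arg_cong[OF normal_Theta_Z, of det] carrier_matD(2)[OF Z(1)] unfolding B_def by (simp add: of_int_hom.hom_det)
    also have "det (transpose_mat Q * B * Q) = (det Q)\<^sup>2 * det B"
      using Q(1) B by (simp add: det_mult[of _ n] det_transpose[of _ n] power2_eq_square)
    also have "\<dots> = (\<Prod>j<p. int (t j))\<^sup>2"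
      unfolding detQ B_def by (simp add: det_skew_block[of _ p] det_mat_diag)
    finally have "real_of_rat (of_nat m ^ n * det ?A) = real_of_rat (rat_of_int ((\<Prod>j<p. int (t j))\<^sup>2))" by simp
    then have "real m ^ n * real_of_rat (det ?A) = real_of_int ((\<Prod>j<p. int (t j))\<^sup>2)"
      by (simp only: of_rat_mult of_rat_power of_rat_of_nat_eq of_rat_of_int_eq)
    then have "real m ^ n * real_of_rat (det ?A) = ?t\<^sup>2" by simp
    moreover have "real_of_rat (det ?A) = (det T1)\<^sup>2"
      unfolding of_rat_hom.hom_det[symmetric] T1(3)[symmetric]
      using T1(1) n by (simp add: det_mult[of _ n] det_transpose[of _ n] det_J1_mat power2_eq_square)
    ultimately show ?thesis
      using m(1) by (simp add: power_divide n field_simps flip: power_mult)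
  qed
  then have detT1: "\<bar>det T1\<bar> = ?t / real m ^ p"
    using power2_eq_imp_eq[of "\<bar>det T1\<bar>" "?t / real m ^ p"] t0 by simp
  \<comment> \<open>Rationality is visible only in the expression with \<open>t\<close> and
    \<open>m\<close>, since \<open>T1\<close> itself is a real matrix.\<close>
  have "K \<in> \<rat>" unfolding K_eq detT1 by (intro Rats_mult Rats_divide Rats_power Rats_prod) auto
  moreover have "K\<^sup>2 \<in> \<int>" unfolding K(2) by simp
  ultimately have "K \<in> \<int>" by (rule square_in_Ints_imp_Ints)
  then show ?thesis
    using fin K_eq pf detT1 by (simp add: det_mat_diag)
qed

end
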